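(* In the perturbative BF theory in $\mathbb{R}^3$ with structure group $ISU(2)$ and total action $S_{TOT}=S+S_{\phi\pi}$ in the Landau gauge (see context), let $W[J,K]$ be the generating functional of the connected correlation functions of the connection components $A^a_\mu,B^a_\mu$, viewed as the formal sum of its connected Feynman diagrams. Then $W[J,K]$ is given by the sum of connected Feynman diagrams with no loops and with one loop only: $$W[J,K]=W_0[J,K]+W_1[J,K],$$ where $W_0$ is the sum of the connected tree-level diagrams and $W_1$ the sum of the connected one-loop diagrams. Moreover: (i) $W_0[J,K]=U[K]+\int d^3x\,J^a_\mu(x)\,H^a_\mu[K](x)$, where $U[K]$ and $H^a_\mu[K](x)$ depend only on $K$; $U[K]$ is linear in $g$, whereas $H^a_\mu[K](x)$ does not depend on $g$; (ii) $W_1[J,K]$ does not depend on $g$ and does not depend on $J$, that is, $W_1[J,K]=W_1[K]$.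
   Context: Colour indices $a,b,c\in\{1,2,3\}$ and Euclidean vector indices $\mu,\nu,\lambda\in\{1,2,3\}$ are summed when repeated; $\epsilon$ is the totally antisymmetric symbol. Bosonic fields on $\mathbb{R}^3$: $A^a_\mu,B^a_\mu$ (components of an $ISU(2)$ connection) and auxiliary fields $M^a,N^a$. Anticommuting fields: ghosts $c^a,\xi^a$ and antighosts $\overline c^a,\overline\xi^a$. $g$ is a real coupling constant. Set $F^a_{\mu\nu}(A)=\partial_\mu A^a_\nu-\partial_\nu A^a_\mu-\epsilon^{abc}A^b_\mu A^c_\nu$. The action is $S_{TOT}=S+S_{\phi\pi}$ with $$S=\int d^3x\,\epsilon^{\mu\nu\lambda}\Big\{\tfrac12 B^a_\mu F^a_{\nu\lambda}(A)+g\big[\tfrac12A^a_\mu\partial_\nu A^a_\lambda-\tfrac16\epsilon^{abc}A^a_\mu A^b_\nu A^c_\lambda\big]\Big\},$$ $$S_{\phi\pi}=\int d^3x\Big\{M^a\partial^\mu A^a_\mu+N^a\partial^\mu B^a_\mu+\partial^\mu\overline c^a(\partial_\mu c^a-\epsilon^{abc}A^b_\mu c^c)+\partial^\mu\overline\xi^a(\partial_\mu\xi^a-\epsilon^{abc}A^b_\mu\xi^c-\epsilon^{abc}B^b_\mu c^c)\Big\}.$$ With $\Delta(x)=\int\frac{d^3k}{(2\pi)^3}\frac{e^{ikx}}{k^2}$, the nonvanishing propagators (Wick contractions, written $\overline{\phi\,\psi}$) determined by the quadratic part of $S_{TOT}$ are $\overline{A^a_\mu(x)B^b_\nu(y)}=-i\delta^{ab}\epsilon_{\mu\nu\lambda}\partial^\lambda\Delta(x-y)$,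 $\overline{B^a_\mu(x)B^b_\nu(y)}=ig\,\delta^{ab}\epsilon_{\mu\nu\lambda}\partial^\lambda\Delta(x-y)$, $\overline{A^a_\mu(x)M^b(y)}=\overline{B^a_\mu(x)N^b(y)}=-i\delta^{ab}\partial_\mu\Delta(x-y)$, and for the ghosts $\overline{c^a(x)\overline c^b(y)}=\overline{\xi^a(x)\overline\xi^b(y)}=i\delta^{ab}\Delta(x-y)$; all other contractions vanish (in particular the $AA$, $c\,\overline\xi$ and $\xi\,\overline c$ ones). The interaction vertices are $i$ times the cubic terms of $S_{TOT}$. The generating functional, with classical sources $J^a_\mu(x),K^a_\mu(x)$, is defined perturbatively by $$e^{iW[J,K]}=\frac{\int D(\text{fields})\,e^{iS_{TOT}}\,e^{i\int d^3x(J^a_\mu A^a_\mu+K^a_\mu B^a_\mu)}}{\int D(\text{fields})\,e^{iS_{TOT}}},$$ i.e. $iW[J,K]$ is the formal sum of connected source-dependent Feynman diagrams built by Wick contractions from the propagators, the vertices, and the source insertions $i\int JA$ and $i\int KB$. The statement concerns the combinatorial (Wick-contraction) structure of the diagrams; ultraviolet renormalization of individual diagrams is not at issue. The number of loops of a diagram is its number of independent cycles, ghost lines included. *)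

theory Defs
  imports "HOL-Analysis.Analysis" "HOL-Library.Function_Algebras"
begin

section \<open>Fields and the classical Lagrangian\<close>

text \<open>The type \<^typ>\<open>3\<close> serves both for colour indices and for Euclidean vector indices. In a field
  component the colour index comes first, the vector index (if any) second.\<close>

datatype field =
    Afld 3 3 | Bfld 3 3 | Mfld 3 | Nfld 3
  | gh_c 3 | gh_cbar 3 | gh_xi 3 | gh_xibar 3

fun fermionic :: "field \<Rightarrow> bool" where
  "fermionic (gh_c a) = True"
| "fermionic (gh_cbar a) = True"
| "fermionic (gh_xi a) = True"
| "fermionic (gh_xibar a) = True"
| "fermionic \<phi> = False"

datatype leg = Fld field | Der 3 field  \<comment> \<open>\<open>\<phi>\<close> and \<open>\<partial>\<^sub>\<mu> \<phi>\<close>\<close>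

fun field_of :: "leg \<Rightarrow> field" where
  "field_of (Fld \<phi>) = \<phi>"
| "field_of (Der \<mu> \<phi>) = \<phi>"

definition eps :: "3 \<Rightarrow> 3 \<Rightarrow> 3 \<Rightarrow> real" where
  "eps i j k = det (vector [axis i 1, axis j 1, axis k 1] :: real^3^3)"

text \<open>Local polynomials in the fields and their first derivatives: noncommutative polynomials, given
  by the coefficient of each word of legs. The order of the letters matters for the ghosts. Sums and
  differences are the pointwise ones of \<^theory>\<open>HOL-Library.Function_Algebras\<close>; the product
  is the one induced by concatenation of words (and not the pointwise one).\<close>

type_synonym lpoly = "leg list \<Rightarrow> real"

definition letter :: "leg \<Rightarrow> lpoly" where
  "letter l = (\<lambda>m. if m = [l] then 1 else 0)"

abbreviation fld :: "field \<Rightarrow> lpoly" where "fld \<phi> \<equiv> letter (Fld \<phi>)"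

abbreviation dfld :: "3 \<Rightarrow> field \<Rightarrow> lpoly" where "dfld \<mu> \<phi> \<equiv> letter (Der \<mu> \<phi>)"

definition lscale :: "real \<Rightarrow> lpoly \<Rightarrow> lpoly" (infixr "\<odot>" 76) where
  "r \<odot> p = (\<lambda>m. r * p m)"

definition lmult :: "lpoly \<Rightarrow> lpoly \<Rightarrow> lpoly" (infixr "\<star>" 77) where
  "p \<star> q = (\<lambda>m. \<Sum>i\<le>length m. p (take i m) * q (drop i m))"

definition F_curv :: "3 \<Rightarrow> 3 \<Rightarrow> 3 \<Rightarrow> lpoly" where
  "F_curv a \<mu> \<nu> = dfld \<mu> (Afld a \<nu>) - dfld \<nu> (Afld a \<mu>)
     - (\<Sum>b\<in>UNIV. \<Sum>c\<in>UNIV. eps a b c \<odot> fld (Afld b \<mu>) \<star> fld (Afld c \<nu>))"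

definition lagr_BF :: "real \<Rightarrow> lpoly" where
  "lagr_BF g = (\<Sum>\<mu>\<in>UNIV. \<Sum>\<nu>\<in>UNIV. \<Sum>\<rho>\<in>UNIV. eps \<mu> \<nu> \<rho> \<odot>
     ((\<Sum>a\<in>UNIV. (1/2) \<odot> fld (Bfld a \<mu>) \<star> F_curv a \<nu> \<rho>)
      + g \<odot> ((\<Sum>a\<in>UNIV. (1/2) \<odot> fld (Afld a \<mu>) \<star> dfld \<nu> (Afld a \<rho>))
             - (\<Sum>a\<in>UNIV. \<Sum>b\<in>UNIV. \<Sum>c\<in>UNIV.
                  (1/6 * eps a b c) \<odot> fld (Afld a \<mu>) \<star> fld (Afld b \<nu>) \<star> fld (Afld c \<rho>)))))"

definition lagr_gf :: lpoly where
  "lagr_gf = (\<Sum>\<mu>\<in>UNIV. \<Sum>a\<in>UNIV.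
       fld (Mfld a) \<star> dfld \<mu> (Afld a \<mu>) + fld (Nfld a) \<star> dfld \<mu> (Bfld a \<mu>)
     + dfld \<mu> (gh_cbar a) \<star>
         (dfld \<mu> (gh_c a)
          - (\<Sum>b\<in>UNIV. \<Sum>c\<in>UNIV. eps a b c \<odot> fld (Afld b \<mu>) \<star> fld (gh_c c)))
     + dfld \<mu> (gh_xibar a) \<star>
         (dfld \<mu> (gh_xi a)
          - (\<Sum>b\<in>UNIV. \<Sum>c\<in>UNIV. eps a b c \<odot> fld (Afld b \<mu>) \<star> fld (gh_xi c))
          - (\<Sum>b\<in>UNIV. \<Sum>c\<in>UNIV. eps a b c \<odot> fld (Bfld b \<mu>) \<star> fld (gh_c c))))"

definition lagr_tot :: "real \<Rightarrow> lpoly" where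
  "lagr_tot g = lagr_BF g + lagr_gf"


section \<open>Propagators\<close>

text \<open>The Fourier integral of \<open>1 / k\<^sup>2\<close> is only conditionally convergent, whence the momentum cutoff
  that is removed in the limit.\<close>

definition Delta :: "real^3 \<Rightarrow> complex" where
  "Delta x = Lim at_top (\<lambda>\<Lambda>::real.
     (LINT k:cball 0 \<Lambda>|lborel. exp (\<i> * of_real (k \<bullet> x)) / of_real ((norm k)\<^sup>2)) / of_real ((2 * pi) ^ 3))"

definition pd :: "3 \<Rightarrow> (real^3 \<Rightarrow> complex) \<Rightarrow> real^3 \<Rightarrow> complex" where
  "pd \<mu> f x = vector_derivative (\<lambda>t. f (x + t *\<^sub>R axis \<mu> 1)) (at 0)"

definition curl_Delta :: "3 \<Rightarrow> 3 \<Rightarrow> real^3 \<Rightarrow> complex" where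
  "curl_Delta \<mu> \<nu> z = (\<Sum>\<rho>\<in>UNIV. of_real (eps \<mu> \<nu> \<rho>) * pd \<rho> Delta z)"

text \<open>\<open>propag g \<phi> \<psi> x y\<close> is the contraction of \<open>\<phi>(x) \<psi>(y)\<close>, in this order; exchanging the two fields
  gives a sign for the anticommuting ones.\<close>

definition propag :: "real \<Rightarrow> field \<Rightarrow> field \<Rightarrow> real^3 \<Rightarrow> real^3 \<Rightarrow> complex" where
  "propag g \<phi> \<psi> x y = (case (\<phi>, \<psi>) of
       (Afld a \<mu>, Bfld b \<nu>) \<Rightarrow> - \<i> * of_bool (a = b) * curl_Delta \<mu> \<nu> (x - y)
     | (Bfld b \<nu>, Afld a \<mu>) \<Rightarrow> - \<i> * of_bool (a = b) * curl_Delta \<mu> \<nu> (y - x)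
     | (Bfld a \<mu>, Bfld b \<nu>) \<Rightarrow> \<i> * of_real g * of_bool (a = b) * curl_Delta \<mu> \<nu> (x - y)
     | (Afld a \<mu>, Mfld b) \<Rightarrow> - \<i> * of_bool (a = b) * pd \<mu> Delta (x - y)
     | (Mfld b, Afld a \<mu>) \<Rightarrow> - \<i> * of_bool (a = b) * pd \<mu> Delta (y - x)
     | (Bfld a \<mu>, Nfld b) \<Rightarrow> - \<i> * of_bool (a = b) * pd \<mu> Delta (x - y)
     | (Nfld b, Bfld a \<mu>) \<Rightarrow> - \<i> * of_bool (a = b) * pd \<mu> Delta (y - x)
     | (gh_c a, gh_cbar b) \<Rightarrow> \<i> * of_bool (a = b) * Delta (x - y)
     | (gh_cbar b, gh_c a) \<Rightarrow> - (\<i> * of_bool (a = b) * Delta (y - x))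
     | (gh_xi a, gh_xibar b) \<Rightarrow> \<i> * of_bool (a = b) * Delta (x - y)
     | (gh_xibar b, gh_xi a) \<Rightarrow> - (\<i> * of_bool (a = b) * Delta (y - x))
     | _ \<Rightarrow> 0)"

fun contraction :: "real \<Rightarrow> leg \<Rightarrow> leg \<Rightarrow> real^3 \<Rightarrow> real^3 \<Rightarrow> complex" where
  "contraction g (Fld \<phi>) (Fld \<psi>) x y = propag g \<phi> \<psi> x y"
| "contraction g (Der \<mu> \<phi>) (Fld \<psi>) x y = pd \<mu> (\<lambda>x'. propag g \<phi> \<psi> x' y) x"
| "contraction g (Fld \<phi>) (Der \<nu> \<psi>) x y = pd \<nu> (\<lambda>y'. propag g \<phi> \<psi> x y') y"
| "contraction g (Der \<mu> \<phi>) (Der \<nu> \<psi>) x y =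
     pd \<mu> (\<lambda>x'. pd \<nu> (\<lambda>y'. propag g \<phi> \<psi> x' y') y) x"


section \<open>Feynman diagrams\<close>

text \<open>A diagram of order \<open>n\<close> is a Wick contraction in the \<open>n\<close>-th term of the expansion of
  the exponential of interaction plus sources: a list of \<open>n\<close> vertices (cubic monomials
  of the Lagrangian, with all indices explicit, or source insertions) and a perfect matching of their
  legs. The leg number \<open>k\<close> of the vertex number \<open>v\<close> is the half-edge \<open>(v, k)\<close>.\<close>

datatype vertex = Inter "leg list" | SrcJ 3 3 | SrcK 3 3

fun legs :: "vertex \<Rightarrow> leg list" where
  "legs (Inter m) = m"
| "legs (SrcJ a \<mu>) = [Fld (Afld a \<mu>)]"
| "legs (SrcK a \<mu>) = [Fld (Bfld a \<mu>)]"

definition vertices :: "real \<Rightarrow> vertex set" where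
  "vertices g = {Inter m |m. length m = 3 \<and> lagr_tot g m \<noteq> 0}
     \<union> {SrcJ a \<mu> |a \<mu>. True} \<union> {SrcK a \<mu> |a \<mu>. True}"

lemma finite_fields: "finite (UNIV :: field set)"
proof -
  have "(UNIV :: field set) =
      (\<Union>a. \<Union>\<mu>. {Afld a \<mu>, Bfld a \<mu>}) \<union>
      (\<Union>a. {Mfld a, Nfld a, gh_c a, gh_cbar a, gh_xi a, gh_xibar a})"
    (is "_ = ?S")
  proof -
    have "\<phi> \<in> ?S" for \<phi>
      by (cases \<phi>) auto
    then show ?thesis by blast
  qed
  moreover have "finite \<dots>"
    by simp
  ultimately show ?thesis by (rule ssubst)
qed

lemma finite_legs: "finite (UNIV :: leg set)"
proof -
  have "(UNIV :: leg set) = Fld ` UNIV \<union> (\<lambda>(\<mu>, \<phi>). Der \<mu> \<phi>) ` (UNIV \<times> UNIV)"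
    (is "_ = ?S")
  proof -
    have "l \<in> ?S" for l
      by (cases l) auto
    then show ?thesis by blast
  qed
  moreover have "finite \<dots>"
    by (intro finite_UnI finite_imageI finite_cartesian_product finite_fields finite_class.finite_UNIV)
  ultimately show ?thesis by (rule ssubst)
qed

lemma finite_vertices: "finite (vertices g)"
proof -
  have "finite {m :: leg list. set m \<subseteq> UNIV \<and> length m = 3}"
    by (rule finite_lists_length_eq[OF finite_legs])
  then have "finite (Inter ` {m. length m = 3 \<and> lagr_tot g m \<noteq> 0})"
    by (intro finite_imageI) (auto elim: rev_finite_subset)
  moreover have "vertices g = Inter ` {m. length m = 3 \<and> lagr_tot g m \<noteq> 0}
      \<union> range (\<lambda>(a, \<mu>). SrcJ a \<mu>) \<union> range (\<lambda>(a, \<mu>). SrcK a \<mu>)"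
    unfolding vertices_def by auto
  ultimately show ?thesis by simp
qed

type_synonym source = "3 \<Rightarrow> 3 \<Rightarrow> real^3 \<Rightarrow> real"

fun vertex_factor :: "real \<Rightarrow> source \<Rightarrow> source \<Rightarrow> vertex \<Rightarrow> real^3 \<Rightarrow> complex" where
  "vertex_factor g J K (Inter m) x = \<i> * of_real (lagr_tot g m)"
| "vertex_factor g J K (SrcJ a \<mu>) x = \<i> * of_real (J a \<mu> x)"
| "vertex_factor g J K (SrcK a \<mu>) x = \<i> * of_real (K a \<mu> x)"

type_synonym half_edge = "nat \<times> nat"
type_synonym edge = "half_edge \<times> half_edge"
type_synonym diagram = "vertex list \<times> edge set"

definition hless :: "half_edge \<Rightarrow> half_edge \<Rightarrow> bool" where
  "hless h h' \<longleftrightarrow> fst h < fst h' \<or> fst h = fst h' \<and> snd h < snd h'"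

definition half_edges :: "vertex list \<Rightarrow> half_edge set" where
  "half_edges vs = {(v, k). v < length vs \<and> k < length (legs (vs ! v))}"

definition leg_at :: "vertex list \<Rightarrow> half_edge \<Rightarrow> leg" where
  "leg_at vs h = legs (vs ! fst h) ! snd h"

definition wick_matching :: "vertex list \<Rightarrow> edge set \<Rightarrow> bool" where
  "wick_matching vs P \<longleftrightarrow>
     P \<subseteq> {(h, h'). h \<in> half_edges vs \<and> h' \<in> half_edges vs \<and> hless h h'} \<and>
     (\<forall>h\<in>half_edges vs. \<exists>!e. e \<in> P \<and> (h = fst e \<or> h = snd e))"

text \<open>Only nonvanishing propagators are admitted as edges.\<close>

definition diagrams :: "real \<Rightarrow> nat \<Rightarrow> diagram set" where
  "diagrams g n = {(vs, P). length vs = n \<and> set vs \<subseteq> vertices g \<and> wick_matching vs P \<and>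
     (\<forall>(h, h')\<in>P. propag g (field_of (leg_at vs h)) (field_of (leg_at vs h')) \<noteq> (\<lambda>x y. 0))}"

text \<open>The sums over diagrams of a given order below are thus genuine finite sums.\<close>

lemma finite_diagrams: "finite (diagrams g n)"
proof -
  have "finite {vs. set vs \<subseteq> vertices g \<and> length vs = n}" (is "finite ?V")
    by (rule finite_lists_length_eq[OF finite_vertices])
  moreover have "finite (Pow (half_edges vs \<times> half_edges vs))" for vs
  proof -
    have "half_edges vs = (SIGMA v:{..<length vs}. {..<length (legs (vs ! v))})"
      by (auto simp: half_edges_def)
    then show ?thesis by simp
  qed
  ultimately have "finite (SIGMA vs:?V. Pow (half_edges vs \<times> half_edges vs))"
    by (intro finite_SigmaI)
  then show ?thesis
    by (rule rev_finite_subset) (auto simp: diagrams_def wick_matching_def)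
qed

fun connected_diagram :: "diagram \<Rightarrow> bool" where
  "connected_diagram (vs, P) \<longleftrightarrow>
     (\<forall>v<length vs. \<forall>w<length vs.
        (v, w) \<in> {(u, u'). \<exists>(h, h')\<in>P. {u, u'} = {fst h, fst h'}}\<^sup>*)"

fun has_source :: "diagram \<Rightarrow> bool" where
  "has_source (vs, P) \<longleftrightarrow> (\<exists>a \<mu>. SrcJ a \<mu> \<in> set vs \<or> SrcK a \<mu> \<in> set vs)"

definition connected_diagrams :: "real \<Rightarrow> nat \<Rightarrow> diagram set" where
  "connected_diagrams g n = {D \<in> diagrams g n. connected_diagram D \<and> has_source D}"

text \<open>The number of loops is the number of independent cycles, i.e. the dimension of the cycle space
  over the field with two elements. The latter consists of the sets of edges in which every vertex
  has even degree (a self-contraction counts twice), with symmetric difference as addition.\<close>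

definition edge_degree :: "edge set \<Rightarrow> nat \<Rightarrow> nat" where
  "edge_degree Q v = card {e \<in> Q. fst (fst e) = v} + card {e \<in> Q. fst (snd e) = v}"

definition cycle_space :: "edge set \<Rightarrow> edge set set" where
  "cycle_space P = {Q. Q \<subseteq> P \<and> (\<forall>v. even (edge_degree Q v))}"

fun loops :: "diagram \<Rightarrow> nat" where
  "loops (vs, P) = (THE l. card (cycle_space P) = 2 ^ l)"

text \<open>The sign of a Wick contraction of anticommuting fields: each pair of crossing
  chords contributes a factor \<open>-1\<close> (every contraction being taken in the order of its legs).\<close>

fun wick_sign :: "diagram \<Rightarrow> complex" where
  "wick_sign (vs, P) = (- 1) ^ card {(e, e'). e \<in> P \<and> e' \<in> P \<and>
      fermionic (field_of (leg_at vs (fst e))) \<and> fermionic (field_of (leg_at vs (fst e'))) \<and>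
      hless (fst e) (fst e') \<and> hless (fst e') (snd e) \<and> hless (snd e) (snd e')}"

fun amplitude :: "real \<Rightarrow> source \<Rightarrow> source \<Rightarrow> diagram \<Rightarrow> (nat \<Rightarrow> real^3) \<Rightarrow> complex" where
  "amplitude g J K (vs, P) x =
     wick_sign (vs, P) * (\<Prod>v<length vs. vertex_factor g J K (vs ! v) (x v)) *
     (\<Prod>(h, h')\<in>P. contraction g (leg_at vs h) (leg_at vs h') (x (fst h)) (x (fst h')))"


section \<open>The generating functional\<close>

text \<open>A formal functional is a formal series of formal integrals over the positions of the vertices.
  It is recorded by its integrands: \<open>f\<close> stands for
  the sum over \<open>n\<close> of the integrals \<open>\<integral> d\<^sup>3x\<^sub>0 \<dots> d\<^sup>3x\<^sub>n\<^sub>-\<^sub>1 f n (x\<^sub>0, \<dots>, x\<^sub>n\<^sub>-\<^sub>1)\<close>. The integrals themselves are not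
  carried out, since those of individual diagrams may require renormalization.\<close>

type_synonym formal_functional = "nat \<Rightarrow> (nat \<Rightarrow> real^3) \<Rightarrow> complex"

text \<open>The diagrams of order \<open>n\<close> have labelled vertices, and carry the factor \<open>1 / n!\<close> of the
  exponential series. Their sum is \<open>\<i> W\<close>, whence the factor \<open>- \<i>\<close>.\<close>

definition W :: "real \<Rightarrow> source \<Rightarrow> source \<Rightarrow> formal_functional" where
  "W g J K n x = - \<i> / fact n * (\<Sum>D\<in>connected_diagrams g n. amplitude g J K D x)"

definition W_loop :: "nat \<Rightarrow> real \<Rightarrow> source \<Rightarrow> source \<Rightarrow> formal_functional" where
  "W_loop l g J K n x =
     - \<i> / fact n * (\<Sum>D\<in>{D \<in> connected_diagrams g n. loops D = l}. amplitude g J K D x)"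

text \<open>The formal functional \<open>\<integral> d\<^sup>3y J\<^sup>a\<^sub>\<mu>(y) H\<^sup>a\<^sub>\<mu>(y)\<close>, where \<open>H\<^sup>a\<^sub>\<mu>(y)\<close> is itself a formal functional. In order \<open>n + 1\<close> the
  variable \<open>y\<close> becomes one of \<open>x\<^sub>0, \<dots>, x\<^sub>n\<close>, and the other ones are the arguments of \<open>H\<close>. The
  integral does not depend on which of them is \<open>y\<close>; averaging over the choices gives the
  representative that treats all integration variables alike, as \<^const>\<open>W\<close> does.\<close>

definition skip :: "nat \<Rightarrow> nat \<Rightarrow> nat" where
  "skip j i = (if i < j then i else Suc i)"

fun source_integral ::
    "source \<Rightarrow> (3 \<Rightarrow> 3 \<Rightarrow> real^3 \<Rightarrow> formal_functional) \<Rightarrow> formal_functional" where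
  "source_integral J H 0 x = 0"
| "source_integral J H (Suc n) x =
     (\<Sum>j\<le>n. \<Sum>a\<in>UNIV. \<Sum>\<mu>\<in>UNIV. of_real (J a \<mu> (x j)) * H a \<mu> (x j) n (x \<circ> skip j)) / of_nat (Suc n)"

end

theory Submission
  imports Defs
begin

text \<open>Give weight 1 to the legs \<open>B\<close>, \<open>cbar\<close>, \<open>\<xi>\<close> and weight 0 to all the other legs. Then every vertex has total
  weight 1, except for the sources \<open>J\<close> and the vertices \<open>g A A A\<close> (weight 0), and every contraction has
  weight 1, except for \<open>B B\<close> (weight 2, propagator proportional to \<open>g\<close>). Summing over all legs, the
  numbers \<open>E\<close> of edges and \<open>V\<close> of vertices satisfy \<open>E + #BB + #AAA + #J = V\<close>. In a connected diagram
  the number of loops is \<open>E - V + 1\<close>, so that \<open>loops + (power of g) + (power of J) = 1\<close>, and the three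
  possibilities are the three parts of the statement.

  To bring the trees with one source \<open>J\<close> into the form \<open>\<integral> J H\<close>, their vertices are relabelled so that
  the source comes first. No signs appear, because ghost lines are closed and trees contain none.\<close>


section \<open>Vertices and propagators\<close>

text \<open>Of all splittings of the word, only the one after its first letter survives. Every
  product in the Lagrangian has a single letter as left factor, so this rule evaluates all of
  them.\<close>

lemma lmult_letter: "(letter l \<star> p) m = (if m \<noteq> [] \<and> hd m = l then p (tl m) else 0)"
proof (cases m)
  case Nil
  then show ?thesis by (simp add: lmult_def letter_def)
next
  case (Cons k ks)
  have "(\<Sum>i\<le>length m. letter l (take i m) * p (drop i m))
      = (\<Sum>i\<le>length m. if i = 1 then (if k = l then p ks else 0) else 0)"
  proof (rule sum.cong)
    fix i assume "i \<in> {..length m}"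
    then show "letter l (take i m) * p (drop i m) = (if i = 1 then (if k = l then p ks else 0) else 0)"
      using Cons by (cases i) (auto simp: letter_def)
  qed simp
  also have "\<dots> = (if k = l then p ks else 0)"
    using Cons by (simp add: sum.delta del: sum.atMost_Suc)
  finally show ?thesis using Cons by (simp add: lmult_def)
qed

text \<open>\<open>S\<close> is only an upper bound for the words that occur, so no value of
  \<open>eps\<close> has to be computed.\<close>

definition supported :: "leg list set \<Rightarrow> lpoly \<Rightarrow> bool" where
  "supported S p \<longleftrightarrow> (\<forall>m. m \<notin> S \<longrightarrow> p m = 0)"

lemma sum_lpoly: "(\<Sum>i\<in>A. p i) m = (\<Sum>i\<in>A. p i m)" for p :: "'i \<Rightarrow> lpoly"
  by (induction A rule: infinite_finite_induct) auto

lemma supported_intros: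
  "supported S p \<Longrightarrow> supported S q \<Longrightarrow> supported S (p + q)"
  "supported S p \<Longrightarrow> supported S q \<Longrightarrow> supported S (p - q)"
  "supported S p \<Longrightarrow> supported S (r \<odot> p)"
  "(\<And>i. supported S (P i)) \<Longrightarrow> supported S (\<Sum>i\<in>A. P i)"
  "supported {m. l # m \<in> S} p \<Longrightarrow> supported S (letter l \<star> p)"
  "[l] \<in> S \<Longrightarrow> supported S (letter l)"
  by (auto simp: supported_def lscale_def sum_lpoly lmult_letter) (auto simp: letter_def)

text \<open>The coefficient of \<open>g\<close> in the action, a Chern-Simons Lagrangian for
  \<open>A\<close>.\<close>

definition lagr_CS :: lpoly where
  "lagr_CS = (\<Sum>\<mu>\<in>UNIV. \<Sum>\<nu>\<in>UNIV. \<Sum>\<rho>\<in>UNIV. eps \<mu> \<nu> \<rho> \<odot>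
     ((\<Sum>a\<in>UNIV. (1/2) \<odot> fld (Afld a \<mu>) \<star> dfld \<nu> (Afld a \<rho>))
             - (\<Sum>a\<in>UNIV. \<Sum>b\<in>UNIV. \<Sum>c\<in>UNIV.
                  (1/6 * eps a b c) \<odot> fld (Afld a \<mu>) \<star> fld (Afld b \<nu>) \<star> fld (Afld c \<rho>))))"

lemma lagr_tot_affine: "lagr_tot g m = lagr_tot 0 m + g * lagr_CS m"
proof -
  have "lagr_BF g m = lagr_BF 0 m + g * lagr_CS m"
    unfolding lagr_BF_def lagr_CS_def
    by (simp add: sum_lpoly lscale_def ring_distribs sum.distrib sum_distrib_left mult.left_commute)
  then show ?thesis by (simp add: lagr_tot_def)
qed

definition A_leg :: "leg \<Rightarrow> bool" where
  "A_leg l \<longleftrightarrow> (\<exists>a \<mu>. l = Fld (Afld a \<mu>))"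

text \<open>An upper bound for the cubic terms at \<open>g = 0\<close>: the coupling
  \<open>B A A\<close> and the ghost couplings. All indices are left free.\<close>

definition plain_words :: "leg list set" where
  "plain_words = {m. \<exists>a b c \<mu> \<nu> \<rho>.
      m = [Fld (Bfld a \<mu>), Fld (Afld b \<nu>), Fld (Afld c \<rho>)] \<or>
      m = [Der \<mu> (gh_cbar a), Fld (Afld b \<nu>), Fld (gh_c c)] \<or>
      m = [Der \<mu> (gh_xibar a), Fld (Afld b \<nu>), Fld (gh_xi c)] \<or>
      m = [Der \<mu> (gh_xibar a), Fld (Bfld b \<nu>), Fld (gh_c c)]}"

text \<open>The implication in the set lets the quadratic words pass, so that only the vertices are
  constrained.\<close>

lemma lagr_CS_supported: "supported {m. length m = 3 \<longrightarrow> list_all A_leg m} lagr_CS"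
  unfolding lagr_CS_def by (intro supported_intros) (auto simp: A_leg_def)

lemma lagr_0_supported: "supported {m. length m = 3 \<longrightarrow> m \<in> plain_words} (lagr_tot 0)"
proof -
  have eq: "lagr_tot 0 = (\<Sum>\<mu>\<in>UNIV. \<Sum>\<nu>\<in>UNIV. \<Sum>\<rho>\<in>UNIV. eps \<mu> \<nu> \<rho> \<odot>
     (\<Sum>a\<in>UNIV. (1/2) \<odot> fld (Bfld a \<mu>) \<star> F_curv a \<nu> \<rho>)) + lagr_gf"
    unfolding lagr_tot_def lagr_BF_def by (rule ext) (simp add: sum_lpoly lscale_def)
  show ?thesis
    unfolding eq lagr_gf_def F_curv_def
    by (intro supported_intros) (auto simp: plain_words_def)
qed

lemma interaction_words:
  assumes "length m = 3" "lagr_tot g m \<noteq> 0"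
  shows "m \<in> plain_words \<or> list_all A_leg m"
  using assms lagr_tot_affine[of g m] lagr_CS_supported lagr_0_supported
  by (auto simp: supported_def)

lemma plain_not_A: "m \<in> plain_words \<Longrightarrow> \<not> list_all A_leg m"
  by (auto simp: plain_words_def A_leg_def)

text \<open>No cubic word belongs both to the part free of \<open>g\<close> and to the Chern-Simons
  part. The affine dependence on \<open>g\<close> is therefore homogeneous, of degree 0 or 1, on
  each cubic word.\<close>

lemma lagr_tot_scale:
  assumes "length m = 3"
  shows "lagr_tot g m = g ^ of_bool (list_all A_leg m) * lagr_tot 1 m"
  using assms lagr_tot_affine[of g m] lagr_tot_affine[of 1 m] lagr_CS_supported lagr_0_supported plain_not_A
  by (auto simp: supported_def)

section \<open>Weights, powers of \<open>g\<close> and powers of \<open>J\<close>\<close>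

fun weight :: "leg \<Rightarrow> nat" where
  "weight l = (case field_of l of Bfld a \<mu> \<Rightarrow> 1 | gh_cbar a \<Rightarrow> 1 | gh_xi a \<Rightarrow> 1 | _ \<Rightarrow> 0)"

fun vertex_g_order :: "vertex \<Rightarrow> nat" where
  "vertex_g_order (Inter m) = of_bool (list_all A_leg m)"
| "vertex_g_order _ = 0"

text \<open>Written as a sum over indices so that it unfolds into the index sums of the integral of
  \<open>J\<close> against \<open>H\<close>.\<close>

definition vertex_J_order :: "vertex \<Rightarrow> nat" where
  "vertex_J_order u = (\<Sum>a\<in>UNIV. \<Sum>\<mu>\<in>UNIV. of_bool (u = SrcJ a \<mu>))"

lemma vertex_J_order_simps [simp]:
  "vertex_J_order (Inter m) = 0"
  "vertex_J_order (SrcJ a \<mu>) = 1"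
  "vertex_J_order (SrcK a \<mu>) = 0"
proof -
  have "(\<Sum>b\<in>UNIV. \<Sum>\<nu>\<in>UNIV. of_bool (SrcJ a \<mu> = SrcJ b \<nu>)) =
     (\<Sum>b\<in>UNIV. \<Sum>\<nu>\<in>UNIV. if b = a then if \<nu> = \<mu> then 1 else (0::nat) else 0)"
    by (intro sum.cong) auto
  also have "\<dots> = (\<Sum>b\<in>UNIV. if b = a then \<Sum>\<nu>\<in>UNIV. if \<nu> = \<mu> then 1 else (0::nat) else 0)"
    by (intro sum.cong) auto
  also have "\<dots> = 1"
    by (simp add: sum.delta)
  finally show "vertex_J_order (SrcJ a \<mu>) = 1" by (simp add: vertex_J_order_def)
qed (simp_all add: vertex_J_order_def)

lemma length_3_all:
  assumes "list_all P m" "length m = 3"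
  obtains x y z where "m = [x,y,z]" "P x" "P y" "P z"
  using assms by (auto simp: numeral_3_eq_3 length_Suc_conv)

lemma vertices_cases [consumes 1]:
  assumes "u \<in> vertices g"
  obtains (plain) m where "u = Inter m" "m \<in> plain_words"
  | (CS) a \<mu> b \<nu> c \<rho> where "u = Inter [Fld (Afld a \<mu>), Fld (Afld b \<nu>), Fld (Afld c \<rho>)]"
  | (J) a \<mu> where "u = SrcJ a \<mu>" | (K) a \<mu> where "u = SrcK a \<mu>"
proof (cases u)
  case (Inter m)
  with assms have m: "length m = 3" "lagr_tot g m \<noteq> 0"
    by (auto simp: vertices_def)
  from interaction_words[OF this] show ?thesis
  proof
    assume "list_all A_leg m"
    then show ?thesis using m(1) Inter CS by (elim length_3_all) (auto simp: A_leg_def)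
  qed (use Inter plain in blast)
qed (use J K in blast)+

lemma vertex_weight:
  assumes "u \<in> vertices g"
  shows "sum_list (map weight (legs u)) + vertex_g_order u + vertex_J_order u = 1"
  using assms by (cases rule: vertices_cases) (auto simp: plain_words_def A_leg_def)

text \<open>A vertex has either two ghost legs or none.\<close>

lemma vertex_ghost_number:
  assumes "u \<in> vertices g"
  shows "even (sum_list (map (\<lambda>l. of_bool (fermionic (field_of l))) (legs u)) :: nat)"
  using assms by (cases rule: vertices_cases) (auto simp: plain_words_def)

text \<open>\<open>M\<close> and \<open>N\<close> enter the action only quadratically, and the cubic
  terms differentiate only ghost fields.\<close>

fun legal_leg :: "leg \<Rightarrow> bool" where
  "legal_leg (Fld (Mfld a)) = False"
| "legal_leg (Fld (Nfld a)) = False"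
| "legal_leg (Fld \<phi>) = True"
| "legal_leg (Der \<mu> \<phi>) = fermionic \<phi>"

lemma vertex_legs:
  assumes "u \<in> vertices g" "l \<in> set (legs u)"
  shows "legal_leg l"
  using assms by (cases rule: vertices_cases) (auto simp: plain_words_def)

lemma vertex_factor_scale:
  assumes "u \<in> vertices g"
  shows "vertex_factor g J K u x = of_real g ^ vertex_g_order u * vertex_factor 1 J K u x"
proof (cases u)
  case (Inter m)
  then have "length m = 3" using assms by (auto simp: vertices_def)
  then show ?thesis using Inter lagr_tot_scale[of m g] by auto
qed auto

text \<open>Vertices are selected by a nonzero coefficient, so those proportional to
  \<open>g\<close> can be lost only at coupling 0.\<close>

lemma vertices_indep:
  assumes "u \<in> vertices g" "vertex_g_order u = 0 \<or> g' \<noteq> 0"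
  shows "u \<in> vertices g'"
proof (cases u)
  case (Inter m)
  then have "length m = 3" "lagr_tot g m \<noteq> 0" using assms by (auto simp: vertices_def)
  then show ?thesis using Inter assms(2) lagr_tot_scale[of m g] lagr_tot_scale[of m g']
    by (auto simp: vertices_def)
qed (auto simp: vertices_def)

definition edge_g_order :: "leg \<Rightarrow> leg \<Rightarrow> nat" where
  "edge_g_order l l' = of_bool (\<exists>a \<mu> b \<nu>. field_of l = Bfld a \<mu> \<and> field_of l' = Bfld b \<nu>)"

lemma propag_scale:
  "propag g (field_of l) (field_of l') = (\<lambda>x y. of_real g ^ edge_g_order l l' * propag 1 (field_of l) (field_of l') x y)"
  by (cases "field_of l"; cases "field_of l'"; intro ext) (auto simp: propag_def[abs_def] edge_g_order_def)

lemma propag_indep: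
  assumes "propag g (field_of l) (field_of l') \<noteq> (\<lambda>x y. 0)" "edge_g_order l l' = 0 \<or> g' \<noteq> 0"
  shows "propag g' (field_of l) (field_of l') \<noteq> (\<lambda>x y. 0)"
  using assms propag_scale[of g l l'] propag_scale[of g' l l'] by (auto simp: fun_eq_iff)

text \<open>The factor \<open>g\<close> arises only between two undifferentiated \<open>B\<close>
  legs. It never has to be pulled out of \<open>pd\<close>, where differentiability of
  \<open>Delta\<close> would come in.\<close>

lemma contraction_scale:
  assumes "legal_leg l" "legal_leg l'"
  shows "contraction g l l' x y = of_real g ^ edge_g_order l l' * contraction 1 l l' x y"
proof (cases "edge_g_order l l' = 0")
  case True
  then show ?thesis using propag_scale[of g l l'] by (cases l; cases l') auto
next
  case False
  then have "\<not> fermionic (field_of l)" "\<not> fermionic (field_of l')"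
    by (auto simp: edge_g_order_def)
  then obtain \<phi> \<psi> where "l = Fld \<phi>" "l' = Fld \<psi>"
    using assms by (cases l; cases l') auto
  then show ?thesis using propag_scale[of g l l'] by auto
qed

text \<open>The pairs \<open>A B\<close>, \<open>c cbar\<close> and \<open>xi xibar\<close> contain
  exactly one leg of weight 1, and \<open>B B\<close> contains two. A line \<open>A M\<close> would
  have weight 0, which is why legal legs are required.\<close>

lemma edge_weight:
  assumes "legal_leg l" "legal_leg l'" "propag g (field_of l) (field_of l') \<noteq> (\<lambda>x y. 0)"
  shows "weight l + weight l' = 1 + edge_g_order l l'"
proof -
  have "\<forall>a. field_of l \<noteq> Mfld a \<and> field_of l \<noteq> Nfld a \<and> field_of l' \<noteq> Mfld a \<and> field_of l' \<noteq> Nfld a"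
    using assms(1,2) by (cases l; cases l') auto
  with assms(3) show ?thesis
    by (cases "field_of l"; cases "field_of l'") (auto simp: propag_def[abs_def] edge_g_order_def)
qed

lemma edge_fermionic:
  assumes "propag g \<phi> \<psi> \<noteq> (\<lambda>x y. 0)"
  shows "fermionic \<phi> \<longleftrightarrow> fermionic \<psi>"
  using assms by (cases \<phi>; cases \<psi>) (auto simp: propag_def[abs_def])

definition AB_edge :: "leg \<Rightarrow> leg \<Rightarrow> bool" where
  "AB_edge l l' \<longleftrightarrow> (\<exists>a \<mu> b \<nu>. (l = Fld (Afld a \<mu>) \<and> l' = Fld (Bfld b \<nu>)) \<or> (l = Fld (Bfld b \<nu>) \<and> l' = Fld (Afld a \<mu>)))"

lemma AB_edgeI:
  assumes "legal_leg l" "legal_leg l'" "propag g (field_of l) (field_of l') \<noteq> (\<lambda>x y. 0)"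
    "edge_g_order l l' = 0" "\<not> fermionic (field_of l)" "\<not> fermionic (field_of l')"
  shows "AB_edge l l'"
proof -
  obtain \<phi> \<psi> where [simp]: "l = Fld \<phi>" "l' = Fld \<psi>"
    using assms by (cases l; cases l') auto
  show ?thesis using assms
    by (cases \<phi>; cases \<psi>) (auto simp: propag_def[abs_def] edge_g_order_def AB_edge_def)
qed

text \<open>Both orders of \<open>A\<close> and \<open>B\<close> are defined by the same expression
  in the positions of the two fields. For ghosts there would be a sign, and for \<open>B B\<close>
  the parity of \<open>Delta\<close> would enter.\<close>

lemma AB_contraction_sym:
  assumes "AB_edge l l'"
  shows "contraction g l' l y x = contraction g l l' x y"
    "propag g (field_of l') (field_of l) y x = propag g (field_of l) (field_of l') x y"
  using assms by (auto simp: AB_edge_def propag_def)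


section \<open>Cycle space of a connected diagram\<close>

lemma card_sym_diff_even:
  assumes "finite A" "finite B"
  shows "even (card (sym_diff A B)) \<longleftrightarrow> (even (card A) \<longleftrightarrow> even (card B))"
proof -
  have "card A = card (A - B) + card (A \<inter> B)" "card B = card (B - A) + card (A \<inter> B)"
    using assms card_Int_Diff[of A B] card_Int_Diff[of B A] by (auto simp: Int_commute)
  moreover have "card (sym_diff A B) = card (A - B) + card (B - A)"
    using assms by (intro card_Un_disjoint) auto
  ultimately show ?thesis by presburger
qed

text \<open>The boundary operator of the graph modulo 2; the sets of edges in its kernel are the
  cycles.\<close>

definition boundary :: "edge set \<Rightarrow> nat set" where
  "boundary Q = {v. odd (edge_degree Q v)}"

lemma boundary_sym_diff:
  assumes "finite Q" "finite R"
  shows "boundary (sym_diff Q R) = sym_diff (boundary Q) (boundary R)"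
proof -
  have "{e \<in> sym_diff Q R. p e} = sym_diff {e \<in> Q. p e} {e \<in> R. p e}" for p
    by auto
  then show ?thesis
    using assms by (auto simp: boundary_def edge_degree_def card_sym_diff_even)
qed

lemma boundary_empty [simp]: "boundary {} = {}"
  by (simp add: boundary_def edge_degree_def)

text \<open>For a self-contraction the two singletons coincide and cancel.\<close>

lemma boundary_single: "boundary {e} = sym_diff {fst (fst e)} {fst (snd e)}"
proof -
  have "card {e' \<in> {e}. p e'} = of_bool (p e)" for p
    by (cases "p e") (simp_all add: Collect_conv_if conj_commute cong: conj_cong)
  then show ?thesis
    by (auto simp: boundary_def edge_degree_def)
qed

text \<open>Handshake lemma: edges are added one at a time, and the boundary of one edge has 0 or 2
  points.\<close>

lemma boundary_even:
  assumes "finite Q"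
  shows "finite (boundary Q) \<and> even (card (boundary Q)) \<and> boundary Q \<subseteq> (\<Union>e\<in>Q. {fst (fst e), fst (snd e)})"
  using assms
proof (induction Q)
  case (insert e Q)
  have "boundary (insert e Q) = sym_diff (boundary {e}) (boundary Q)"
    using insert boundary_sym_diff[of "{e}" Q] by (auto simp: insert_Diff_if)
  moreover have "even (card (boundary {e}))" "finite (boundary {e})"
    by (simp_all add: boundary_single card_sym_diff_even)
  ultimately show ?case
    using insert by (auto simp: card_sym_diff_even boundary_single)
qed simp

text \<open>Over the two-element field, \<open>Q \<mapsto> boundary Q - {0}\<close> is a linear surjection from the sets
  of edges onto the sets of vertices other than \<open>0\<close>. Its kernel is the cycle space, since a
  boundary has even cardinality.\<close>

lemma card_cycle_space:
  assumes fin: "finite P" and n: "n \<noteq> 0"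
    and ends: "\<And>h h'. (h, h') \<in> P \<Longrightarrow> fst h < n \<and> fst h' < n"
    and conn: "\<And>v w. v < n \<Longrightarrow> w < n \<Longrightarrow> (v, w) \<in> {(u, u'). \<exists>(h, h')\<in>P. {u, u'} = {fst h, fst h'}}\<^sup>*"
  shows "card (cycle_space P) * 2 ^ (n - 1) = 2 ^ card P"
proof -
  define f where "f Q = boundary Q - {0}" for Q
  have finP: "finite Q" if "Q \<in> Pow P" for Q using that fin finite_subset by auto
  have f_diff: "f (sym_diff Q R) = sym_diff (f Q) (f R)" if "Q \<in> Pow P" "R \<in> Pow P" for Q R
    using boundary_sym_diff[OF finP finP, OF that] by (auto simp: f_def)
  have kernel: "cycle_space P = {Q \<in> Pow P. f Q = {}}"
  proof (intro set_eqI iffI)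
    fix Q assume "Q \<in> {Q \<in> Pow P. f Q = {}}"
    then have Q: "Q \<subseteq> P" "boundary Q \<subseteq> {0}" by (auto simp: f_def)
    moreover have "even (card (boundary Q))" using boundary_even[of Q] finP Q by auto
    ultimately have "boundary Q = {}" by (auto simp: subset_singleton_iff)
    then show "Q \<in> cycle_space P" using Q by (auto simp: cycle_space_def boundary_def)
  qed (auto simp: cycle_space_def f_def boundary_def)
  define Im where "Im = f ` Pow P"
  have closed: "sym_diff S T \<in> Im" if "S \<in> Im" "T \<in> Im" for S T
  proof -
    from that obtain Q R where QR: "Q \<in> Pow P" "R \<in> Pow P" "S = f Q" "T = f R" by (auto simp: Im_def)
    then have "sym_diff S T = f (sym_diff Q R)" using f_diff by simp
    then show ?thesis using QR unfolding Im_def by blast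
  qed
  have empty: "{} \<in> Im" unfolding Im_def f_def by (rule image_eqI[of _ _ "{}"]) auto
  \<comment> \<open>Adding up the boundaries of the edges along a path telescopes to its two
    endpoints.\<close>
  have path: "sym_diff {v} {w} - {0} \<in> Im"
    if "(v, w) \<in> {(u, u'). \<exists>(h, h')\<in>P. {u, u'} = {fst h, fst h'}}\<^sup>*" for v w
    using that
  proof (induction rule: rtrancl_induct)
    case base
    then show ?case using empty by simp
  next
    case (step y z)
    then obtain e where e: "e \<in> P" "{y, z} = {fst (fst e), fst (snd e)}" by auto
    have "sym_diff {y} {z} = boundary {e}"
      unfolding boundary_single using e(2) by (auto simp: doubleton_eq_iff)
    then have "sym_diff {y} {z} - {0} = f {e}" by (simp add: f_def)
    then have "sym_diff {y} {z} - {0} \<in> Im" using e by (auto simp: Im_def)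
    from closed[OF step.IH this]
    have "sym_diff (sym_diff {v} {y} - {0}) (sym_diff {y} {z} - {0}) \<in> Im" .
    also have "sym_diff (sym_diff {v} {y} - {0}) (sym_diff {y} {z} - {0}) = sym_diff {v} {z} - {0}"
      by auto
    finally show ?case .
  qed
  have image: "Im = Pow {1..<n}"
  proof (intro subset_antisym subsetI)
    fix S assume "S \<in> Im"
    then obtain Q where Q: "Q \<subseteq> P" "S = f Q" by (auto simp: Im_def)
    have "v < n" if "v \<in> boundary Q" for v
    proof -
      have "v \<in> (\<Union>e\<in>Q. {fst (fst e), fst (snd e)})"
        using boundary_even[of Q] finP[of Q] Q that by blast
      then obtain e where "e \<in> P" "v = fst (fst e) \<or> v = fst (snd e)" using Q by blast
      then show ?thesis using ends[of "fst e" "snd e"] by auto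
    qed
    then show "S \<in> Pow {1..<n}" using Q by (auto simp: f_def Suc_le_eq)
  next
    fix S assume "S \<in> Pow {1..<n}"
    then have "finite S" "S \<subseteq> {1..<n}" by (auto intro: finite_subset)
    then show "S \<in> Im"
    proof (induction S)
      case (insert v S)
      \<comment> \<open>A path from the deleted vertex \<open>0\<close> to \<open>v\<close> leaves
        just \<open>{v}\<close>, and the singletons generate all subsets.\<close>
      have "sym_diff {0} {v} - {0} \<in> Im" using insert n by (intro path conn) auto
      then have "{v} \<in> Im" using insert by (simp add: insert_Diff_if)
      moreover have "S \<in> Im" using insert by simp
      ultimately have "sym_diff {v} S \<in> Im" by (rule closed)
      moreover have "sym_diff {v} S = insert v S" using insert by auto
      ultimately show ?case by simp
    qed (rule empty)
  qed
  have fibre: "card {Q \<in> Pow P. f Q = S} = card (cycle_space P)" if "S \<in> Im" for S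
  proof -
    from that obtain R where R: "R \<in> Pow P" "S = f R" by (auto simp: Im_def)
    \<comment> \<open>Every fibre is a coset of the kernel; adding \<open>R\<close> modulo 2 is its
      own inverse.\<close>
    have "bij_betw (\<lambda>Q. sym_diff Q R) {Q \<in> Pow P. f Q = S} (cycle_space P)"
    proof (rule bij_betw_byWitness[where f' = "\<lambda>Q. sym_diff Q R"])
      show "(\<lambda>Q. sym_diff Q R) ` {Q \<in> Pow P. f Q = S} \<subseteq> cycle_space P"
        using R unfolding kernel by (auto simp: f_diff)
      show "(\<lambda>Q. sym_diff Q R) ` cycle_space P \<subseteq> {Q \<in> Pow P. f Q = S}"
        using R unfolding kernel by (auto simp: f_diff)
    qed auto
    then show ?thesis by (rule bij_betw_same_card)
  qed
  have "card (Pow P) = (\<Sum>S\<in>Im. card {Q \<in> Pow P. f Q = S})"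
  proof -
    have "Pow P = (\<Union>S\<in>Im. {Q \<in> Pow P. f Q = S})" by (auto simp: Im_def)
    then have "card (Pow P) = card (\<Union>S\<in>Im. {Q \<in> Pow P. f Q = S})"
      by (rule arg_cong)
    also have "\<dots> = (\<Sum>S\<in>Im. card {Q \<in> Pow P. f Q = S})"
      using fin by (intro card_UN_disjoint) (auto simp: image)
    finally show ?thesis .
  qed
  also have "\<dots> = (\<Sum>S\<in>Im. card (cycle_space P))" by (intro sum.cong fibre) auto
  also have "\<dots> = card Im * card (cycle_space P)" by simp
  finally show ?thesis using fin by (simp add: image card_Pow mult.commute)
qed

section \<open>Sums over the half-edges of a Wick contraction\<close>

lemma half_edges_SIGMA: "half_edges vs = (SIGMA v:{..<length vs}. {..<length (legs (vs ! v))})"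
  by (auto simp: half_edges_def)

lemma finite_half_edges: "finite (half_edges vs)"
  by (simp add: half_edges_SIGMA)

lemma wick_matching_finite: "wick_matching vs P \<Longrightarrow> finite P"
  by (rule finite_subset[of _ "half_edges vs \<times> half_edges vs"])
    (auto simp: wick_matching_def finite_half_edges)

lemma wick_matchingD:
  assumes "wick_matching vs P" "e \<in> P"
  shows "fst e \<in> half_edges vs" "snd e \<in> half_edges vs" "hless (fst e) (snd e)"
  using assms by (auto simp: wick_matching_def)

text \<open>A perfect matching partitions the half-edges into the two-element sets of ends of its
  edges.\<close>

lemma sum_wick_matching:
  assumes m: "wick_matching vs P"
  shows "(\<Sum>h\<in>half_edges vs. f h) = (\<Sum>e\<in>P. f (fst e) + f (snd e))"
proof -
  have eq: "half_edges vs = (\<Union>e\<in>P. {fst e, snd e})"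
  proof (intro subset_antisym subsetI)
    fix h assume "h \<in> half_edges vs"
    then obtain e where "e \<in> P" "h = fst e \<or> h = snd e"
      using m unfolding wick_matching_def by blast
    then show "h \<in> (\<Union>e\<in>P. {fst e, snd e})" by auto
  qed (use m in \<open>auto dest: wick_matchingD\<close>)
  have "{fst e, snd e} \<inter> {fst e', snd e'} = {}" if "e \<in> P" "e' \<in> P" "e \<noteq> e'" for e e'
  proof (rule ccontr)
    assume "{fst e, snd e} \<inter> {fst e', snd e'} \<noteq> {}"
    then obtain h where h: "h \<in> {fst e, snd e}" "h \<in> {fst e', snd e'}" by blast
    then have "h \<in> half_edges vs" using eq that by auto
    then have "\<exists>!e. e \<in> P \<and> (h = fst e \<or> h = snd e)" using m by (simp add: wick_matching_def)
    then show False using h that by auto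
  qed
  then have "(\<Sum>h\<in>half_edges vs. f h) = (\<Sum>e\<in>P. \<Sum>h\<in>{fst e, snd e}. f h)"
    unfolding eq using wick_matching_finite[OF m] by (intro sum.UNION_disjoint) auto
  also have "\<dots> = (\<Sum>e\<in>P. f (fst e) + f (snd e))"
  proof (rule sum.cong)
    fix e assume "e \<in> P"
    then have "fst e \<noteq> snd e" using wick_matchingD(3)[OF m, of e] by (auto simp: hless_def)
    then show "(\<Sum>h\<in>{fst e, snd e}. f h) = f (fst e) + f (snd e)" by simp
  qed simp
  finally show ?thesis .
qed

lemma sum_half_edges_at:
  assumes "v < length vs"
  shows "(\<Sum>k<length (legs (vs ! v)). f (leg_at vs (v, k))) = sum_list (map f (legs (vs ! v)))"
  by (simp add: leg_at_def sum_list_sum_nth atLeast0LessThan)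

lemma sum_half_edges:
  "(\<Sum>h\<in>half_edges vs. f (leg_at vs h)) = (\<Sum>v<length vs. sum_list (map f (legs (vs ! v))))"
proof -
  have "(\<Sum>h\<in>half_edges vs. f (leg_at vs h)) =
     (\<Sum>v<length vs. \<Sum>k<length (legs (vs ! v)). f (leg_at vs (v, k)))"
    unfolding half_edges_SIGMA by (subst sum.Sigma) auto
  then show ?thesis by (simp add: sum_half_edges_at)
qed


section \<open>Counting loops\<close>

fun g_order :: "diagram \<Rightarrow> nat" where
  "g_order (vs, P) = (\<Sum>v<length vs. vertex_g_order (vs ! v)) +
     (\<Sum>(h, h')\<in>P. edge_g_order (leg_at vs h) (leg_at vs h'))"

fun J_order :: "diagram \<Rightarrow> nat" where
  "J_order (vs, P) = (\<Sum>v<length vs. vertex_J_order (vs ! v))"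

lemma diagramsD:
  assumes "(vs, P) \<in> diagrams g n"
  shows "length vs = n" "wick_matching vs P" "finite P"
    "\<And>v. v < n \<Longrightarrow> vs ! v \<in> vertices g"
    "\<And>h h'. (h, h') \<in> P \<Longrightarrow> h \<in> half_edges vs \<and> h' \<in> half_edges vs"
    "\<And>h h'. (h, h') \<in> P \<Longrightarrow>
       propag g (field_of (leg_at vs h)) (field_of (leg_at vs h')) \<noteq> (\<lambda>x y. 0)"
proof -
  show "length vs = n" "wick_matching vs P" "\<And>v. v < n \<Longrightarrow> vs ! v \<in> vertices g"
    using assms by (auto simp: diagrams_def)
  then show "finite P" "\<And>h h'. (h, h') \<in> P \<Longrightarrow> h \<in> half_edges vs \<and> h' \<in> half_edges vs"
    by (auto intro: wick_matching_finite dest: wick_matchingD)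
  show "propag g (field_of (leg_at vs h)) (field_of (leg_at vs h')) \<noteq> (\<lambda>x y. 0)"
    if "(h, h') \<in> P" for h h'
    using assms that unfolding diagrams_def by blast
qed

lemma leg_at_in: "h \<in> half_edges vs \<Longrightarrow> leg_at vs h \<in> set (legs (vs ! fst h))"
  by (auto simp: half_edges_def leg_at_def)

lemma diagrams_legal_leg:
  assumes "(vs, P) \<in> diagrams g n" "h \<in> half_edges vs"
  shows "legal_leg (leg_at vs h)"
  using vertex_legs[OF diagramsD(4)[OF assms(1), of "fst h"] leg_at_in[OF assms(2)]] assms(2)
    diagramsD(1)[OF assms(1)] by (auto simp: half_edges_def)

text \<open>Double counting of the total weight of the half-edges. By edges it exceeds
  \<open>card P\<close> by the number of \<open>B B\<close> lines; by vertices it falls short of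
  \<open>length vs\<close> by the number of \<open>A A A\<close> vertices and \<open>J\<close>
  sources.\<close>

lemma power_counting:
  assumes D: "(vs, P) \<in> diagrams g n"
  shows "card P + g_order (vs, P) + J_order (vs, P) = length vs"
proof -
  have "(\<Sum>h\<in>half_edges vs. weight (leg_at vs h)) =
      (\<Sum>e\<in>P. weight (leg_at vs (fst e)) + weight (leg_at vs (snd e)))"
    by (rule sum_wick_matching[OF diagramsD(2)[OF D]])
  also have "\<dots> = (\<Sum>e\<in>P. 1 + edge_g_order (leg_at vs (fst e)) (leg_at vs (snd e)))"
  proof (rule sum.cong)
    fix e assume "e \<in> P"
    then have e: "(fst e, snd e) \<in> P" by simp
    show "weight (leg_at vs (fst e)) + weight (leg_at vs (snd e)) =
        1 + edge_g_order (leg_at vs (fst e)) (leg_at vs (snd e))"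
      using diagramsD(5)[OF D e] diagramsD(6)[OF D e]
      by (intro edge_weight[of _ _ g] diagrams_legal_leg[OF D]) auto
  qed simp
  also have "\<dots> = card P + (\<Sum>(h, h')\<in>P. edge_g_order (leg_at vs h) (leg_at vs h'))"
    by (simp add: sum.distrib case_prod_beta sum_Suc)
  finally have "(\<Sum>v<length vs. sum_list (map weight (legs (vs ! v)))) =
     card P + (\<Sum>(h, h')\<in>P. edge_g_order (leg_at vs h) (leg_at vs h'))"
    by (simp only: sum_half_edges)
  moreover have "(\<Sum>v<length vs. sum_list (map weight (legs (vs ! v))) + vertex_g_order (vs ! v)
      + vertex_J_order (vs ! v)) = (\<Sum>v<length vs. 1)"
    using diagramsD(1,4)[OF D] by (intro sum.cong vertex_weight) auto
  ultimately show ?thesis by (simp add: sum.distrib)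
qed

text \<open>Euler's formula, read off from the cardinality of the cycle space.\<close>

lemma loops_formula:
  assumes m: "wick_matching vs P" and c: "connected_diagram (vs, P)" and n: "vs \<noteq> []"
  shows "card (cycle_space P) = 2 ^ loops (vs, P)" "card P + 1 = length vs + loops (vs, P)"
proof -
  have fin: "finite P" using m by (rule wick_matching_finite)
  have "fst h < length vs \<and> fst h' < length vs" if "(h, h') \<in> P" for h h'
    using wick_matchingD[OF m that] by (auto simp: half_edges_def)
  then have eq: "card (cycle_space P) * 2 ^ (length vs - 1) = 2 ^ card P"
    using c n fin by (intro card_cycle_space) auto
  \<comment> \<open>Divisibility provides the inequality that keeps the subtraction of naturals in
    \<open>l\<close> from being truncated.\<close>
  then have "(2::nat) ^ (length vs - 1) dvd 2 ^ card P" by (metis dvd_triv_right)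
  then have le: "length vs - 1 \<le> card P" by (simp add: dvd_power_iff_le)
  define l where "l = card P - (length vs - 1)"
  have "card (cycle_space P) * 2 ^ (length vs - 1) = 2 ^ l * 2 ^ (length vs - 1)"
    unfolding eq l_def power_add[symmetric] using le by simp
  then have card: "card (cycle_space P) = 2 ^ l" by simp
  then have "loops (vs, P) = l" by simp
  then show "card (cycle_space P) = 2 ^ loops (vs, P)" "card P + 1 = length vs + loops (vs, P)"
    using card le n unfolding l_def by (auto simp: Suc_le_eq)
qed

lemma connected_diagramsD:
  assumes "(vs, P) \<in> connected_diagrams g n"
  shows "(vs, P) \<in> diagrams g n" "connected_diagram (vs, P)" "has_source (vs, P)" "vs \<noteq> []"
  using assms by (auto simp: connected_diagrams_def)

text \<open>Eliminating \<open>card P\<close> between \<open>power_counting\<close> and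
  \<open>loops_formula\<close> leaves three natural numbers with sum 1, so exactly one of them is
  1.\<close>

lemma loop_counting:
  assumes "D \<in> connected_diagrams g n"
  shows "loops D + g_order D + J_order D = 1"
proof -
  obtain vs P where [simp]: "D = (vs, P)" by (cases D)
  note D = connected_diagramsD[OF assms[unfolded this]]
  show ?thesis
    using power_counting[OF D(1)] loops_formula(2)[OF diagramsD(2)[OF D(1)] D(2,4)] by simp
qed

text \<open>The value at coupling 1 serves as the coefficient free of \<open>g\<close>. With
  \<open>0 ^ 0 = 1\<close> the formula also covers \<open>g = 0\<close>.\<close>

lemma amplitude_scale:
  assumes "D \<in> diagrams g n"
  shows "amplitude g J K D x = of_real g ^ g_order D * amplitude 1 J K D x"
proof -
  obtain vs P where [simp]: "D = (vs, P)" by (cases D)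
  note D = assms[unfolded this]
  have "(\<Prod>v<length vs. vertex_factor g J K (vs ! v) (x v)) =
     (\<Prod>v<length vs. of_real g ^ vertex_g_order (vs ! v) * vertex_factor 1 J K (vs ! v) (x v))"
    using diagramsD(1,4)[OF D] by (intro prod.cong vertex_factor_scale) auto
  moreover have "(\<Prod>(h, h')\<in>P. contraction g (leg_at vs h) (leg_at vs h') (x (fst h)) (x (fst h'))) =
     (\<Prod>(h, h')\<in>P. of_real g ^ edge_g_order (leg_at vs h) (leg_at vs h') *
        contraction 1 (leg_at vs h) (leg_at vs h') (x (fst h)) (x (fst h')))"
    using diagramsD(5)[OF D] diagrams_legal_leg[OF D]
    by (intro prod.cong) (auto intro!: contraction_scale)
  ultimately show ?thesis
    by (simp add: prod.distrib case_prod_beta power_add power_sum)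
qed

text \<open>The set of diagrams depends on \<open>g\<close> only because vanishing vertices and
  propagators are discarded, which affects diagrams of positive order in \<open>g\<close> at
  coupling 0.\<close>

lemma connected_diagrams_indep:
  assumes "D \<in> connected_diagrams g n" "g_order D = 0 \<or> g' \<noteq> 0"
  shows "D \<in> connected_diagrams g' n"
proof -
  obtain vs P where [simp]: "D = (vs, P)" by (cases D)
  note D = connected_diagramsD[OF assms(1)[unfolded this]]
  note D1 = diagramsD[OF D(1)]
  have "vs ! v \<in> vertices g'" if v: "v < length vs" for v
  proof (rule vertices_indep)
    show "vs ! v \<in> vertices g" using D1(1,4) v by blast
    show "vertex_g_order (vs ! v) = 0 \<or> g' \<noteq> 0" using assms(2) v by auto
  qed
  then have "set vs \<subseteq> vertices g'" by (auto simp: in_set_conv_nth)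
  moreover have "propag g' (field_of (leg_at vs h)) (field_of (leg_at vs h')) \<noteq> (\<lambda>x y. 0)"
    if e: "(h, h') \<in> P" for h h'
  proof (rule propag_indep[OF D1(6)[OF e]])
    have "g_order D = 0 \<Longrightarrow> \<forall>e\<in>P. edge_g_order (leg_at vs (fst e)) (leg_at vs (snd e)) = 0"
      using D1(3) by (simp add: case_prod_beta)
    then show "edge_g_order (leg_at vs h) (leg_at vs h') = 0 \<or> g' \<noteq> 0" using assms(2) e by force
  qed
  ultimately have "(vs, P) \<in> diagrams g' n"
    using D1(1,2) unfolding diagrams_def by blast
  then show ?thesis using D(2,3) by (simp add: connected_diagrams_def)
qed

section \<open>Dependence on \<open>J\<close> and absence of ghosts in trees\<close>

lemma vertex_factor_cong_J:
  "vertex_J_order u = 0 \<Longrightarrow> vertex_factor g J K u x = vertex_factor g J' K u x"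
  by (cases u) auto

lemma amplitude_cong_J:
  assumes "J_order D = 0"
  shows "amplitude g J K D x = amplitude g J' K D x"
proof -
  obtain vs P where [simp]: "D = (vs, P)" by (cases D)
  have "(\<Prod>v<length vs. vertex_factor g J K (vs ! v) (x v)) =
        (\<Prod>v<length vs. vertex_factor g J' K (vs ! v) (x v))"
    using assms by (intro prod.cong vertex_factor_cong_J) auto
  then show ?thesis by simp
qed

text \<open>Evaluation at \<open>J = 0\<close> thus singles out the diagrams without
  \<open>J\<close> sources.\<close>

lemma amplitude_no_J:
  assumes "J_order D \<noteq> 0"
  shows "amplitude g (\<lambda>a \<mu> y. 0) K D x = 0"
proof -
  obtain vs P where [simp]: "D = (vs, P)" by (cases D)
  from assms obtain v where v: "v < length vs" "vertex_J_order (vs ! v) \<noteq> 0" by auto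
  then have "vertex_factor g (\<lambda>a \<mu> y. 0) K (vs ! v) (x v) = 0" by (cases "vs ! v") auto
  then have "(\<Prod>v<length vs. vertex_factor g (\<lambda>a \<mu> y. 0) K (vs ! v) (x v)) = 0"
    using v by (intro prod_zero) auto
  then show ?thesis by simp
qed

text \<open>Ghost lines are closed, since the vertices have an even number of ghost legs.\<close>

lemma tree_no_ghosts:
  assumes D: "(vs, P) \<in> connected_diagrams g n" and tree: "loops (vs, P) = 0"
    and h: "h \<in> half_edges vs"
  shows "\<not> fermionic (field_of (leg_at vs h))"
proof
  let ?ferm = "\<lambda>h. fermionic (field_of (leg_at vs h))"
  assume ferm: "?ferm h"
  note D1 = connected_diagramsD[OF D] and D2 = diagramsD[OF connected_diagramsD(1)[OF D]]
  have ferm_iff: "?ferm (fst e) \<longleftrightarrow> ?ferm (snd e)" if "e \<in> P" for e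
    using D2(6)[of "fst e" "snd e"] that by (intro edge_fermionic[of g]) auto
  \<comment> \<open>The ghost lines together form a cycle: the degree of \<open>Q\<close> at a
    vertex is its number of ghost legs.\<close>
  define Q where "Q = {e \<in> P. ?ferm (fst e)}"
  have "even (edge_degree Q v)" for v
  proof -
    have card_Q: "card {e \<in> Q. p e} = (\<Sum>e\<in>P. of_bool (?ferm (fst e) \<and> p e))" for p
      using D2(3) by (simp add: Q_def Int_def conj_assoc)
    \<comment> \<open>Both ends of a line have the same statistics. Testing each end separately
      turns the degree into a sum over half-edges.\<close>
    have "(\<Sum>e\<in>P. of_bool (?ferm (fst e) \<and> p e) :: nat) = (\<Sum>e\<in>P. of_bool (?ferm (snd e) \<and> p e))" for p
      by (intro sum.cong) (simp_all add: ferm_iff)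
    then have "edge_degree Q v = (\<Sum>e\<in>P. of_bool (?ferm (fst e) \<and> fst (fst e) = v))
        + (\<Sum>e\<in>P. of_bool (?ferm (snd e) \<and> fst (snd e) = v))"
      by (simp only: edge_degree_def card_Q)
    also have "\<dots> = (\<Sum>h\<in>half_edges vs. of_bool (?ferm h \<and> fst h = v))"
      by (simp only: sum_wick_matching[OF D2(2)] sum.distrib)
    also have "\<dots> = (\<Sum>u<length vs. if u = v then \<Sum>k<length (legs (vs ! v)). of_bool (?ferm (v, k)) else 0)"
    proof -
      have "(\<Sum>h\<in>half_edges vs. of_bool (?ferm h \<and> fst h = v)) =
        (\<Sum>u<length vs. \<Sum>k<length (legs (vs ! u)). of_bool (?ferm (u, k) \<and> u = v))"
        unfolding half_edges_SIGMA by (subst sum.Sigma) (auto intro!: sum.cong)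
      also have "\<dots> = (\<Sum>u<length vs. if u = v then \<Sum>k<length (legs (vs ! v)). of_bool (?ferm (v, k)) else 0)"
        by (intro sum.cong) auto
      finally show ?thesis .
    qed
    also have "\<dots> = (if v < length vs then \<Sum>k<length (legs (vs ! v)). of_bool (?ferm (v, k)) else 0)"
      by (simp add: sum.delta)
    finally have deg: "edge_degree Q v =
        (if v < length vs then \<Sum>k<length (legs (vs ! v)). of_bool (?ferm (v, k)) else 0)" .
    show ?thesis
    proof (cases "v < length vs")
      case True
      then have "edge_degree Q v = sum_list (map (\<lambda>l. of_bool (fermionic (field_of l))) (legs (vs ! v)))"
        unfolding deg sum_half_edges_at[OF True, symmetric] by simp
      with vertex_ghost_number[OF D2(4)[of v]] D2(1) True show ?thesis by simp
    qed (simp add: deg)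
  qed
  then have "Q \<in> cycle_space P" by (auto simp: cycle_space_def Q_def)
  moreover have "{} \<in> cycle_space P" by (simp add: cycle_space_def edge_degree_def)
  \<comment> \<open>In a tree the empty set is the only cycle, so there are no ghost lines.\<close>
  moreover have "card (cycle_space P) = 1"
    using loops_formula(1)[OF D2(2) D1(2,4)] tree by simp
  ultimately have "Q = {}" by (metis card_1_singletonE singletonD)
  moreover obtain e where "e \<in> P" "h = fst e \<or> h = snd e"
    using D2(2) h unfolding wick_matching_def by blast
  ultimately show False using ferm ferm_iff[of e] unfolding Q_def by blast
qed


section \<open>Relabelling of vertices\<close>

definition relabel_half :: "(nat \<Rightarrow> nat) \<Rightarrow> half_edge \<Rightarrow> half_edge" where
  "relabel_half \<rho> h = (\<rho> (fst h), snd h)"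

text \<open>Edges list the earlier half-edge first, an order that a permutation of the vertices may
  reverse.\<close>

definition sort_edge :: "edge \<Rightarrow> edge" where
  "sort_edge e = (if hless (fst e) (snd e) then e else (snd e, fst e))"

definition relabel_edge :: "(nat \<Rightarrow> nat) \<Rightarrow> edge \<Rightarrow> edge" where
  "relabel_edge \<rho> e = sort_edge (relabel_half \<rho> (fst e), relabel_half \<rho> (snd e))"

text \<open>The old vertex \<open>v\<close> becomes the vertex \<open>\<rho> v\<close>; as
  \<open>permute_list\<close> reads old positions from new ones, the inverse appears.\<close>

fun relabel :: "(nat \<Rightarrow> nat) \<Rightarrow> diagram \<Rightarrow> diagram" where
  "relabel \<rho> (vs, P) = (permute_list (inv \<rho>) vs, relabel_edge \<rho> ` P)"

lemma hless_linear: "h \<noteq> h' \<Longrightarrow> hless h h' \<or> hless h' h"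
  by (auto simp: hless_def prod_eq_iff)

lemma relabel_edge_cases:
  "relabel_edge \<rho> e = (relabel_half \<rho> (fst e), relabel_half \<rho> (snd e)) \<or>
   relabel_edge \<rho> e = (relabel_half \<rho> (snd e), relabel_half \<rho> (fst e))"
  by (auto simp: relabel_edge_def sort_edge_def)

lemma relabel_edge_inverse:
  assumes "inj \<rho>" "hless (fst e) (snd e)"
  shows "relabel_edge (inv \<rho>) (relabel_edge \<rho> e) = e"
proof -
  have "relabel_half (inv \<rho>) (relabel_half \<rho> h) = h" for h
    using assms(1) by (simp add: relabel_half_def)
  moreover have "\<not> hless (snd e) (fst e)" using assms(2) by (auto simp: hless_def)
  ultimately show ?thesis
    using relabel_edge_cases[of \<rho> e] assms(2)
    by (elim disjE) (simp_all add: relabel_edge_def[of "inv \<rho>"] sort_edge_def)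
qed

lemma nth_relabel:
  assumes "\<rho> permutes {..<length vs}" "v < length vs"
  shows "permute_list (inv \<rho>) vs ! \<rho> v = vs ! v"
  using assms permutes_in_image[OF assms(1), of v] permutes_inv[OF assms(1)]
  by (simp add: permute_list_nth permutes_inverses)

lemma half_edges_relabel:
  assumes \<rho>: "\<rho> permutes {..<length vs}"
  shows "half_edges (permute_list (inv \<rho>) vs) = relabel_half \<rho> ` half_edges vs"
proof (intro subset_antisym subsetI)
  fix h assume h: "h \<in> half_edges (permute_list (inv \<rho>) vs)"
  define v where "v = inv \<rho> (fst h)"
  have v: "\<rho> v = fst h" using permutes_inverses[OF \<rho>] by (simp add: v_def)
  then have "v < length vs" using h permutes_in_image[OF \<rho>, of v] by (auto simp: half_edges_def)
  then have "(v, snd h) \<in> half_edges vs"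
    using h v nth_relabel[OF \<rho>, of v] by (auto simp: half_edges_def)
  then show "h \<in> relabel_half \<rho> ` half_edges vs"
    using v by (intro image_eqI[of _ _ "(v, snd h)"]) (auto simp: relabel_half_def)
next
  fix h assume "h \<in> relabel_half \<rho> ` half_edges vs"
  then obtain v k where v: "h = (\<rho> v, k)" "v < length vs" "k < length (legs (vs ! v))"
    by (auto simp: half_edges_def relabel_half_def)
  then show "h \<in> half_edges (permute_list (inv \<rho>) vs)"
    using nth_relabel[OF \<rho> v(2)] permutes_in_image[OF \<rho>, of v] by (simp add: half_edges_def)
qed

lemma leg_at_relabel:
  assumes "\<rho> permutes {..<length vs}" "h \<in> half_edges vs"
  shows "leg_at (permute_list (inv \<rho>) vs) (relabel_half \<rho> h) = leg_at vs h"
  using assms nth_relabel[OF assms(1), of "fst h"] by (auto simp: leg_at_def relabel_half_def half_edges_def)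

text \<open>Half-edges are mapped bijectively, and sorting the ends of an edge does not change
  incidence.\<close>

lemma wick_matching_relabel:
  assumes \<rho>: "\<rho> permutes {..<length vs}" and m: "wick_matching vs P"
  shows "wick_matching (permute_list (inv \<rho>) vs) (relabel_edge \<rho> ` P)"
proof -
  have inj: "relabel_half \<rho> h = relabel_half \<rho> h' \<longleftrightarrow> h = h'" for h h'
    by (simp add: relabel_half_def prod_eq_iff inj_eq[OF permutes_inj[OF \<rho>]])
  have ends: "relabel_half \<rho> h = fst (relabel_edge \<rho> e) \<or> relabel_half \<rho> h = snd (relabel_edge \<rho> e)
      \<longleftrightarrow> h = fst e \<or> h = snd e" for h e
    using relabel_edge_cases[of \<rho> e] by (elim disjE) (simp_all add: inj disj_commute)
  have "relabel_edge \<rho> e \<in> {(h, h'). h \<in> half_edges (permute_list (inv \<rho>) vs) \<and>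
      h' \<in> half_edges (permute_list (inv \<rho>) vs) \<and> hless h h'}" if "e \<in> P" for e
  proof -
    note e = wick_matchingD[OF m that]
    then have "relabel_half \<rho> (fst e) \<noteq> relabel_half \<rho> (snd e)" by (auto simp: inj hless_def)
    from hless_linear[OF this] e show ?thesis
      by (auto simp: half_edges_relabel[OF \<rho>] relabel_edge_def sort_edge_def)
  qed
  moreover have "\<exists>!e. e \<in> relabel_edge \<rho> ` P \<and> (k = fst e \<or> k = snd e)"
    if "k \<in> half_edges (permute_list (inv \<rho>) vs)" for k
  proof -
    from that obtain h where h: "h \<in> half_edges vs" "k = relabel_half \<rho> h"
      by (auto simp: half_edges_relabel[OF \<rho>])
    then have "\<exists>!e. e \<in> P \<and> (h = fst e \<or> h = snd e)" using m by (auto simp: wick_matching_def)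
    then obtain e where e: "e \<in> P" "h = fst e \<or> h = snd e"
      "\<And>e'. e' \<in> P \<Longrightarrow> h = fst e' \<or> h = snd e' \<Longrightarrow> e' = e" by metis
    show ?thesis
    proof (rule ex1I[of _ "relabel_edge \<rho> e"])
      show "relabel_edge \<rho> e \<in> relabel_edge \<rho> ` P \<and>
          (k = fst (relabel_edge \<rho> e) \<or> k = snd (relabel_edge \<rho> e))"
        using e(1,2) unfolding h(2) ends by simp
      show "e' = relabel_edge \<rho> e" if "e' \<in> relabel_edge \<rho> ` P \<and> (k = fst e' \<or> k = snd e')" for e'
      proof -
        from that obtain e'' where e'': "e'' \<in> P" "e' = relabel_edge \<rho> e''" by blast
        with that have "h = fst e'' \<or> h = snd e''" unfolding h(2) by (simp only: ends)
        with e'' show ?thesis using e(3) by blast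
      qed
    qed
  qed
  ultimately show ?thesis
    unfolding wick_matching_def by (intro conjI ballI image_subsetI)
qed

lemma connected_relabel:
  assumes \<rho>: "\<rho> permutes {..<length vs}" and c: "connected_diagram (vs, P)"
  shows "connected_diagram (relabel \<rho> (vs, P))"
proof -
  define R where "R Q = {(u :: nat, u'). \<exists>(h :: half_edge, h' :: half_edge)\<in>Q. {u, u'} = {fst h, fst h'}}" for Q
  have step: "(\<rho> u, \<rho> u') \<in> R (relabel_edge \<rho> ` P)" if "(u, u') \<in> R P" for u u'
  proof -
    from that obtain e where e: "e \<in> P" "{u, u'} = {fst (fst e), fst (snd e)}" by (auto simp: R_def)
    have "{\<rho> u, \<rho> u'} = \<rho> ` {u, u'}" by simp
    also have "\<dots> = {fst (fst (relabel_edge \<rho> e)), fst (snd (relabel_edge \<rho> e))}"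
      using relabel_edge_cases[of \<rho> e] unfolding e(2) by (auto simp: relabel_half_def)
    finally have "{\<rho> u, \<rho> u'} = {fst (fst (relabel_edge \<rho> e)), fst (snd (relabel_edge \<rho> e))}" .
    then have "\<exists>e\<in>P. {\<rho> u, \<rho> u'} = {fst (fst (relabel_edge \<rho> e)), fst (snd (relabel_edge \<rho> e))}"
      using e(1) by blast
    then show ?thesis by (simp add: R_def case_prod_beta)
  qed
  have "(v, w) \<in> (R (relabel_edge \<rho> ` P))\<^sup>*" if "v < length vs" "w < length vs" for v w
  proof -
    have "inv \<rho> v < length vs" "inv \<rho> w < length vs"
      using that permutes_in_image[OF permutes_inv[OF \<rho>]] by auto
    then have "(inv \<rho> v, inv \<rho> w) \<in> (R P)\<^sup>*" using c by (auto simp: R_def)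
    then have "(\<rho> (inv \<rho> v), \<rho> (inv \<rho> w)) \<in> (R (relabel_edge \<rho> ` P))\<^sup>*"
      by (induction rule: rtrancl_induct) (auto intro: step rtrancl_into_rtrancl)
    then show ?thesis by (simp add: permutes_inverses[OF \<rho>])
  qed
  then show ?thesis by (simp add: R_def)
qed

lemma relabel_inverse:
  assumes \<rho>: "\<rho> permutes {..<length vs}" and m: "wick_matching vs P"
  shows "relabel (inv \<rho>) (relabel \<rho> (vs, P)) = (vs, P)"
proof -
  have "permute_list \<rho> (permute_list (inv \<rho>) vs) = vs"
    using nth_relabel[OF \<rho>] permutes_in_image[OF \<rho>]
    by (intro nth_equalityI) (simp_all add: permute_list_nth \<rho>)
  moreover have "relabel_edge (inv \<rho>) ` relabel_edge \<rho> ` P = P"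
    using relabel_edge_inverse[OF permutes_inj[OF \<rho>]] wick_matchingD(3)[OF m]
    by (force simp: image_image)
  ultimately show ?thesis by (simp add: permutes_inv_inv[OF \<rho>])
qed

text \<open>With only \<open>A B\<close> lines, an edge reversed by sorting keeps its contraction,
  and there are no ghost signs to track.\<close>

lemma relabel_connected_diagram:
  assumes D: "(vs, P) \<in> connected_diagrams g n" and \<rho>: "\<rho> permutes {..<n}"
    and AB: "\<And>h h'. (h, h') \<in> P \<Longrightarrow> AB_edge (leg_at vs h) (leg_at vs h')"
  shows "relabel \<rho> (vs, P) \<in> connected_diagrams g n"
    and "loops (relabel \<rho> (vs, P)) = loops (vs, P)"
    and "amplitude g J K (relabel \<rho> (vs, P)) x = amplitude g J K (vs, P) (x \<circ> \<rho>)"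
proof -
  note D1 = connected_diagramsD[OF D] and D2 = diagramsD[OF connected_diagramsD(1)[OF D]]
  have \<rho>': "\<rho> permutes {..<length vs}" using \<rho> D2(1) by simp
  define vs' P' where "vs' = permute_list (inv \<rho>) vs" and "P' = relabel_edge \<rho> ` P"
  have relabel: "relabel \<rho> (vs, P) = (vs', P')" by (simp add: vs'_def P'_def)
  have set: "set vs' = set vs" and len: "length vs' = n"
    using permutes_inv[OF \<rho>'] D2(1) by (simp_all add: vs'_def)
  have m: "wick_matching vs' P'" unfolding vs'_def P'_def by (rule wick_matching_relabel[OF \<rho>' D2(2)])
  have legs: "leg_at vs' (relabel_half \<rho> (fst e)) = leg_at vs (fst e)"
    "leg_at vs' (relabel_half \<rho> (snd e)) = leg_at vs (snd e)" if "e \<in> P" for e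
    using leg_at_relabel[OF \<rho>'] wick_matchingD[OF D2(2) that] by (simp_all add: vs'_def)
  have AB': "AB_edge (leg_at vs (fst e)) (leg_at vs (snd e))" if "e \<in> P" for e
    using AB[of "fst e" "snd e"] that by simp
  have propag: "propag g (field_of (leg_at vs' h)) (field_of (leg_at vs' h')) \<noteq> (\<lambda>x y. 0)"
    if e': "(h, h') \<in> P'" for h h'
  proof -
    from e' obtain e where e: "e \<in> P" "(h, h') = relabel_edge \<rho> e" by (auto simp: P'_def)
    have nz: "propag g (field_of (leg_at vs (fst e))) (field_of (leg_at vs (snd e))) \<noteq> (\<lambda>x y. 0)"
      using D2(6)[of "fst e" "snd e"] e by simp
    then have "propag g (field_of (leg_at vs (snd e))) (field_of (leg_at vs (fst e))) \<noteq> (\<lambda>x y. 0)"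
      using AB_contraction_sym(2)[OF AB'[OF e(1)], of g] by (auto simp: fun_eq_iff)
    with nz show ?thesis using relabel_edge_cases[of \<rho> e] e legs[OF e(1)] by auto
  qed
  have "set vs \<subseteq> vertices g" using D1(1) by (simp add: diagrams_def)
  then have "(vs', P') \<in> diagrams g n" using set len m propag unfolding diagrams_def by blast
  moreover have conn: "connected_diagram (vs', P')"
    using connected_relabel[OF \<rho>' D1(2)] by (simp only: relabel)
  moreover have "has_source (vs', P')" using D1(3) set by simp
  ultimately show "relabel \<rho> (vs, P) \<in> connected_diagrams g n"
    unfolding relabel connected_diagrams_def by blast
  have inj: "inj_on (relabel_edge \<rho>) P"
    using relabel_edge_inverse[OF permutes_inj[OF \<rho>]] wick_matchingD(3)[OF D2(2)]
    by (intro inj_on_inverseI[of _ "relabel_edge (inv \<rho>)"]) auto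
  \<comment> \<open>By \<open>loops_formula\<close> the number of loops depends only on the numbers
    of vertices and edges, which relabelling preserves.\<close>
  have "vs' \<noteq> []" using len D2(1) D1(4) by auto
  then have "card P' + 1 = length vs' + loops (vs', P')" by (rule loops_formula(2)[OF m conn])
  moreover have "card P + 1 = length vs + loops (vs, P)" by (rule loops_formula(2)[OF D2(2) D1(2,4)])
  ultimately show "loops (relabel \<rho> (vs, P)) = loops (vs, P)"
    unfolding relabel using card_image[OF inj] len D2(1) by (simp add: P'_def)
  have bosonic: "\<not> fermionic (field_of (leg_at vs (fst e)))" "\<not> fermionic (field_of (leg_at vs (snd e)))"
    if "e \<in> P" for e
    using AB'[OF that] by (auto simp: AB_edge_def)
  have bosonic': "\<not> fermionic (field_of (leg_at vs' (fst e)))" if "e \<in> P'" for e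
  proof -
    from that obtain e' where e': "e' \<in> P" "e = relabel_edge \<rho> e'" by (auto simp: P'_def)
    show ?thesis
      using relabel_edge_cases[of \<rho> e'] bosonic[OF e'(1)] legs[OF e'(1)] unfolding e'(2)
      by (elim disjE) simp_all
  qed
  have "{(e, e'). e \<in> P \<and> e' \<in> P \<and>
      fermionic (field_of (leg_at vs (fst e))) \<and> fermionic (field_of (leg_at vs (fst e'))) \<and>
      hless (fst e) (fst e') \<and> hless (fst e') (snd e) \<and> hless (snd e) (snd e')} = {}"
    using bosonic by blast
  then have sign: "wick_sign (vs, P) = 1" by (simp only: wick_sign.simps card.empty power_0)
  have "{(e, e'). e \<in> P' \<and> e' \<in> P' \<and>
      fermionic (field_of (leg_at vs' (fst e))) \<and> fermionic (field_of (leg_at vs' (fst e'))) \<and>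
      hless (fst e) (fst e') \<and> hless (fst e') (snd e) \<and> hless (snd e) (snd e')} = {}"
    using bosonic' by blast
  then have sign': "wick_sign (vs', P') = 1" by (simp only: wick_sign.simps card.empty power_0)
  have "(\<Prod>v<n. vertex_factor g J K (vs' ! v) (x v)) =
      (\<Prod>v<n. vertex_factor g J K (vs' ! \<rho> v) (x (\<rho> v)))"
    using prod.permute[OF \<rho>, of "\<lambda>v. vertex_factor g J K (vs' ! v) (x v)"] by (simp add: o_def)
  also have "\<dots> = (\<Prod>v<n. vertex_factor g J K (vs ! v) (x (\<rho> v)))"
    using nth_relabel[OF \<rho>'] D2(1) by (intro prod.cong) (auto simp: vs'_def)
  finally have vertex_prod: "(\<Prod>v<n. vertex_factor g J K (vs' ! v) (x v)) =
      (\<Prod>v<n. vertex_factor g J K (vs ! v) (x (\<rho> v)))" .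
  have "(\<Prod>(h, h')\<in>P'. contraction g (leg_at vs' h) (leg_at vs' h') (x (fst h)) (x (fst h'))) =
      (\<Prod>e\<in>P. case relabel_edge \<rho> e of (h, h') \<Rightarrow>
        contraction g (leg_at vs' h) (leg_at vs' h') (x (fst h)) (x (fst h')))"
    unfolding P'_def by (simp add: prod.reindex[OF inj])
  also have "\<dots> = (\<Prod>(h, h')\<in>P. contraction g (leg_at vs h) (leg_at vs h') (x (\<rho> (fst h))) (x (\<rho> (fst h'))))"
  proof (rule prod.cong)
    fix e assume e: "e \<in> P"
    show "(case relabel_edge \<rho> e of (h, h') \<Rightarrow>
        contraction g (leg_at vs' h) (leg_at vs' h') (x (fst h)) (x (fst h'))) =
      (case e of (h, h') \<Rightarrow> contraction g (leg_at vs h) (leg_at vs h') (x (\<rho> (fst h))) (x (\<rho> (fst h'))))"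
      using relabel_edge_cases[of \<rho> e]
    proof
      assume "relabel_edge \<rho> e = (relabel_half \<rho> (fst e), relabel_half \<rho> (snd e))"
      then show ?thesis by (simp add: case_prod_beta legs[OF e]) (simp add: relabel_half_def)
    next
      assume "relabel_edge \<rho> e = (relabel_half \<rho> (snd e), relabel_half \<rho> (fst e))"
      then show ?thesis using AB_contraction_sym(1)[OF AB'[OF e], of g]
        by (simp add: case_prod_beta legs[OF e]) (simp add: relabel_half_def)
    qed
  qed simp
  finally show "amplitude g J K (relabel \<rho> (vs, P)) x = amplitude g J K (vs, P) (x \<circ> \<rho>)"
    unfolding relabel amplitude.simps sign sign' using vertex_prod len D2(1) by simp
qed

text \<open>The presence of \<open>J\<close> uses up the total 1 in \<open>loop_counting\<close>,
  which excludes \<open>B B\<close> lines. Ghost lines are excluded by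
  \<open>tree_no_ghosts\<close>, and \<open>M\<close>, \<open>N\<close> by legality of the
  legs.\<close>

lemma J_tree_AB_edges:
  assumes D: "(vs, P) \<in> connected_diagrams g n" and tree: "loops (vs, P) = 0"
    and J: "J_order (vs, P) \<noteq> 0" and e: "(h, h') \<in> P"
  shows "AB_edge (leg_at vs h) (leg_at vs h')"
proof -
  note D1 = connected_diagramsD[OF D] and D2 = diagramsD[OF connected_diagramsD(1)[OF D]]
  have hh: "h \<in> half_edges vs" "h' \<in> half_edges vs" using D2(5)[OF e] by auto
  have "g_order (vs, P) = 0" using loop_counting[OF D] J by linarith
  then have "\<forall>e\<in>P. edge_g_order (leg_at vs (fst e)) (leg_at vs (snd e)) = 0"
    using D2(3) by (simp add: case_prod_beta)
  then have "edge_g_order (leg_at vs h) (leg_at vs h') = 0" using e by force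
  then show ?thesis
    using diagrams_legal_leg[OF D1(1) hh(1)] diagrams_legal_leg[OF D1(1) hh(2)] D2(6)[OF e]
      tree_no_ghosts[OF D tree hh(1)] tree_no_ghosts[OF D tree hh(2)]
    by (intro AB_edgeI)
qed

section \<open>Tree diagrams\<close>

definition J_trees :: "real \<Rightarrow> nat \<Rightarrow> nat \<Rightarrow> 3 \<Rightarrow> 3 \<Rightarrow> diagram set" where
  "J_trees g n j a \<mu> = {D \<in> connected_diagrams g n. loops D = 0 \<and> fst D ! j = SrcJ a \<mu>}"

text \<open>One \<open>J\<close> source exhausts the sum in \<open>loop_counting\<close>, so the
  marked one is the only one and no power of \<open>g\<close> is left.\<close>

lemma J_trees_order:
  assumes "D \<in> J_trees g n j a \<mu>" "j < n"
  shows "J_order D = 1" "g_order D = 0"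
    "\<And>v. v < n \<Longrightarrow> v \<noteq> j \<Longrightarrow> vertex_J_order (fst D ! v) = 0"
proof -
  obtain vs P where [simp]: "D = (vs, P)" by (cases D)
  have D: "(vs, P) \<in> connected_diagrams g n" "loops (vs, P) = 0" "vs ! j = SrcJ a \<mu>"
    using assms by (auto simp: J_trees_def)
  have len: "length vs = n" using diagramsD(1)[OF connected_diagramsD(1)[OF D(1)]] .
  have J: "J_order (vs, P) = 1 + (\<Sum>v\<in>{..<n} - {j}. vertex_J_order (vs ! v))"
    using assms(2) D(3) len by (simp add: sum.remove[of "{..<n}" j])
  then show "J_order D = 1" "g_order D = 0" using loop_counting[OF D(1)] by auto
  then have "(\<Sum>v\<in>{..<n} - {j}. vertex_J_order (vs ! v)) = 0" using J by simp
  then show "vertex_J_order (fst D ! v) = 0" if "v < n" "v \<noteq> j" for v using that by simp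
qed

lemma J_trees_indep:
  assumes "j < n"
  shows "J_trees g n j a \<mu> = J_trees g' n j a \<mu>"
proof -
  have "J_trees g n j a \<mu> \<subseteq> J_trees g' n j a \<mu>" for g g'
    using J_trees_order(2)[OF _ assms] connected_diagrams_indep[of _ g n g']
    unfolding J_trees_def by blast
  then show ?thesis by blast
qed

text \<open>\<open>J\<close> enters through the marked vertex alone. Putting the constant 1 in its
  place keeps the factor \<open>\<i>\<close> of that vertex.\<close>

lemma amplitude_J_trees:
  assumes "D \<in> J_trees g n j a \<mu>" "j < n"
  shows "amplitude g J K D x = of_real (J a \<mu> (x j)) * amplitude 1 (\<lambda>a \<mu> y. 1) K D x"
proof -
  obtain vs P where [simp]: "D = (vs, P)" by (cases D)
  have D: "(vs, P) \<in> connected_diagrams g n" "vs ! j = SrcJ a \<mu>"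
    using assms by (auto simp: J_trees_def)
  note diag = connected_diagramsD(1)[OF D(1)]
  have len: "length vs = n" using diagramsD(1)[OF diag] .
  have "(\<Prod>v<n. vertex_factor 1 J K (vs ! v) (x v)) =
      \<i> * of_real (J a \<mu> (x j)) * (\<Prod>v\<in>{..<n} - {j}. vertex_factor 1 J K (vs ! v) (x v))"
    using assms(2) D(2) by (simp add: prod.remove[of "{..<n}" j])
  also have "(\<Prod>v\<in>{..<n} - {j}. vertex_factor 1 J K (vs ! v) (x v)) =
      (\<Prod>v\<in>{..<n} - {j}. vertex_factor 1 (\<lambda>a \<mu> y. 1) K (vs ! v) (x v))"
    using J_trees_order(3)[OF assms] by (intro prod.cong vertex_factor_cong_J) auto
  also have "\<i> * of_real (J a \<mu> (x j)) * \<dots> =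
      of_real (J a \<mu> (x j)) * (\<Prod>v<n. vertex_factor 1 (\<lambda>a \<mu> y. 1) K (vs ! v) (x v))"
    using assms(2) D(2) by (simp add: prod.remove[of "{..<n}" j])
  finally have "amplitude 1 J K D x = of_real (J a \<mu> (x j)) * amplitude 1 (\<lambda>a \<mu> y. 1) K D x"
    by (simp add: len)
  then show ?thesis
    using amplitude_scale[OF diag, of J K x] J_trees_order(2)[OF assms] by simp
qed

text \<open>Relabelling by \<open>\<rho>\<close> is a bijection from the trees with source at
  \<open>i\<close> to those with source at \<open>j\<close>.\<close>

lemma sum_J_trees_relabel:
  assumes \<rho>: "\<rho> permutes {..<n}" and j: "\<rho> i = j" "i < n" "j < n"
  shows "(\<Sum>D\<in>J_trees g n j a \<mu>. amplitude g J K D x) =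
    (\<Sum>D\<in>J_trees g n i a \<mu>. amplitude g J K D (x \<circ> \<rho>))"
proof -
  \<comment> \<open>Stated for an arbitrary permutation, to be used for \<open>\<rho>\<close> and
    for its inverse.\<close>
  have rel: "relabel \<sigma> D \<in> J_trees g n (\<sigma> v) a \<mu> \<and>
      amplitude g J K (relabel \<sigma> D) y = amplitude g J K D (y \<circ> \<sigma>) \<and> relabel (inv \<sigma>) (relabel \<sigma> D) = D"
    if \<sigma>: "\<sigma> permutes {..<n}" and D: "D \<in> J_trees g n v a \<mu>" and v: "v < n" for \<sigma> D v y
  proof -
    obtain vs P where [simp]: "D = (vs, P)" by (cases D)
    have D': "(vs, P) \<in> connected_diagrams g n" "loops (vs, P) = 0" "vs ! v = SrcJ a \<mu>"
      using D by (auto simp: J_trees_def)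
    note diag = diagramsD[OF connected_diagramsD(1)[OF D'(1)]]
    have "J_order (vs, P) \<noteq> 0" using J_trees_order(1)[OF D v] by simp
    from J_tree_AB_edges[OF D'(1,2) this]
    have AB: "\<And>h h'. (h, h') \<in> P \<Longrightarrow> AB_edge (leg_at vs h) (leg_at vs h')" .
    have "fst (relabel \<sigma> (vs, P)) ! \<sigma> v = vs ! v" using nth_relabel[of \<sigma> vs v] \<sigma> v diag(1) by simp
    moreover have "relabel (inv \<sigma>) (relabel \<sigma> (vs, P)) = (vs, P)"
      using \<sigma> diag(1,2) by (intro relabel_inverse) auto
    ultimately show ?thesis
      using relabel_connected_diagram[OF D'(1) \<sigma> AB] D'(2,3)
      unfolding J_trees_def \<open>D = (vs, P)\<close> by simp
  qed
  have inv: "inv \<rho> permutes {..<n}" "inv (inv \<rho>) = \<rho>" "inv \<rho> j = i"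
    using permutes_inv[OF \<rho>] permutes_inv_inv[OF \<rho>] permutes_inverses[OF \<rho>] j by auto
  have "x \<circ> \<rho> \<circ> inv \<rho> = x" using permutes_inverses[OF \<rho>] by (auto simp: fun_eq_iff)
  then show ?thesis
    using rel[OF \<rho> _ j(2)] rel[OF inv(1) _ j(3)] j inv
    by (intro sum.reindex_bij_witness[of _ "relabel \<rho>" "relabel (inv \<rho>)"]) auto
qed

text \<open>This permutation moves \<open>0\<close> to \<open>j\<close> and keeps the order of the
  other vertices.\<close>

lemma skip_permutes:
  assumes "j \<le> n"
  shows "case_nat j (skip j) permutes {..<Suc n}"
proof (rule bij_imp_permutes)
  have "inj_on (case_nat j (skip j)) {..<Suc n}"
    by (auto simp: inj_on_def skip_def split: nat.splits if_splits)
  moreover have "case_nat j (skip j) ` {..<Suc n} \<subseteq> {..<Suc n}"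
    using assms by (auto simp: skip_def split: nat.splits)
  ultimately show "bij_betw (case_nat j (skip j)) {..<Suc n} {..<Suc n}"
    by (simp add: bij_betw_def endo_inj_surj)
  show "case_nat j (skip j) v = v" if "v \<notin> {..<Suc n}" for v
    using that assms by (cases v) (auto simp: skip_def)
qed

text \<open>A tree has at most one \<open>J\<close> source. Without it the amplitude equals its
  value at \<open>J = 0\<close>; with it that value vanishes, and exactly one indicator records the
  place and the indices of the source.\<close>

lemma sum_tree_amplitudes:
  "(\<Sum>D\<in>{D \<in> connected_diagrams g n. loops D = 0}. amplitude g J K D x) =
    (\<Sum>D\<in>{D \<in> connected_diagrams g n. loops D = 0}. amplitude g (\<lambda>a \<mu> y. 0) K D x) +
    (\<Sum>j<n. \<Sum>a\<in>UNIV. \<Sum>\<mu>\<in>UNIV. of_real (J a \<mu> (x j)) *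
        (\<Sum>D\<in>J_trees g n j a \<mu>. amplitude 1 (\<lambda>a \<mu> y. 1) K D x))"
proof -
  let ?T = "{D \<in> connected_diagrams g n. loops D = 0}"
  have fin: "finite ?T" using finite_diagrams[of g n] by (auto simp: connected_diagrams_def)
  have "amplitude g J K D x = amplitude g (\<lambda>a \<mu> y. 0) K D x +
      (\<Sum>j<n. \<Sum>a\<in>UNIV. \<Sum>\<mu>\<in>UNIV. of_bool (fst D ! j = SrcJ a \<mu>) * amplitude g J K D x)"
    if D: "D \<in> ?T" for D
  proof -
    obtain vs P where [simp]: "D = (vs, P)" by (cases D)
    have "length vs = n" using D by (auto simp: connected_diagrams_def dest: diagramsD)
    then have "(\<Sum>j<n. \<Sum>a\<in>UNIV. \<Sum>\<mu>\<in>UNIV. of_bool (fst D ! j = SrcJ a \<mu>) * amplitude g J K D x) =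
        of_nat (J_order D) * amplitude g J K D x"
      by (simp add: vertex_J_order_def sum_distrib_right)
    moreover have "J_order D = 0 \<or> J_order D = 1"
    proof -
      from D have "D \<in> connected_diagrams g n" by blast
      from loop_counting[OF this] show ?thesis by linarith
    qed
    moreover have "J_order D = 0 \<Longrightarrow> amplitude g J K D x = amplitude g (\<lambda>a \<mu> y. 0) K D x"
      by (rule amplitude_cong_J)
    moreover have "J_order D = 1 \<Longrightarrow> amplitude g (\<lambda>a \<mu> y. 0) K D x = 0"
      by (rule amplitude_no_J) (simp del: J_order.simps)
    ultimately show ?thesis by (elim disjE) (simp_all del: J_order.simps amplitude.simps)
  qed
  then have "(\<Sum>D\<in>?T. amplitude g J K D x) = (\<Sum>D\<in>?T. amplitude g (\<lambda>a \<mu> y. 0) K D x) +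
    (\<Sum>D\<in>?T. \<Sum>j<n. \<Sum>a\<in>UNIV. \<Sum>\<mu>\<in>UNIV. of_bool (fst D ! j = SrcJ a \<mu>) * amplitude g J K D x)"
    by (simp add: sum.distrib[symmetric])
  also have "(\<Sum>D\<in>?T. \<Sum>j<n. \<Sum>a\<in>UNIV. \<Sum>\<mu>\<in>UNIV. of_bool (fst D ! j = SrcJ a \<mu>) * amplitude g J K D x) =
    (\<Sum>j<n. \<Sum>D\<in>?T. \<Sum>a\<in>UNIV. \<Sum>\<mu>\<in>UNIV. of_bool (fst D ! j = SrcJ a \<mu>) * amplitude g J K D x)"
    by (rule sum.swap)
  also have "\<dots> = (\<Sum>j<n. \<Sum>a\<in>UNIV. \<Sum>D\<in>?T. \<Sum>\<mu>\<in>UNIV. of_bool (fst D ! j = SrcJ a \<mu>) * amplitude g J K D x)"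
    by (intro sum.cong refl sum.swap)
  also have "\<dots> = (\<Sum>j<n. \<Sum>a\<in>UNIV. \<Sum>\<mu>\<in>UNIV. \<Sum>D\<in>?T. of_bool (fst D ! j = SrcJ a \<mu>) * amplitude g J K D x)"
    by (intro sum.cong refl sum.swap)
  also have "\<dots> = (\<Sum>j<n. \<Sum>a\<in>UNIV. \<Sum>\<mu>\<in>UNIV. \<Sum>D\<in>J_trees g n j a \<mu>. amplitude g J K D x)"
  proof (rule sum.cong[OF refl], rule sum.cong[OF refl], rule sum.cong[OF refl])
    fix j a \<mu>
    have "J_trees g n j a \<mu> = {D \<in> ?T. fst D ! j = SrcJ a \<mu>}" by (auto simp: J_trees_def)
    moreover have "(\<Sum>D\<in>?T. of_bool (fst D ! j = SrcJ a \<mu>) * amplitude g J K D x) =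
       (\<Sum>D\<in>?T. if fst D ! j = SrcJ a \<mu> then amplitude g J K D x else 0)"
      by (intro sum.cong refl) simp
    ultimately show "(\<Sum>D\<in>?T. of_bool (fst D ! j = SrcJ a \<mu>) * amplitude g J K D x) =
       (\<Sum>D\<in>J_trees g n j a \<mu>. amplitude g J K D x)"
      by (simp only: sum.inter_filter[OF fin])
  qed
  also have "\<dots> = (\<Sum>j<n. \<Sum>a\<in>UNIV. \<Sum>\<mu>\<in>UNIV. of_real (J a \<mu> (x j)) *
        (\<Sum>D\<in>J_trees g n j a \<mu>. amplitude 1 (\<lambda>a \<mu> y. 1) K D x))"
    unfolding sum_distrib_left by (intro sum.cong refl amplitude_J_trees) auto
  finally show ?thesis .
qed

text \<open>The source sits at vertex \<open>0\<close>. Setting \<open>J = 1\<close> in the amplitude strips off its factor, and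
  \<open>of_nat (Suc n)\<close> cancels the average in \<^const>\<open>source_integral\<close>.\<close>

definition H_functional :: "source \<Rightarrow> 3 \<Rightarrow> 3 \<Rightarrow> real^3 \<Rightarrow> formal_functional" where
  "H_functional K a \<mu> y n z = of_nat (Suc n) * (- \<i> / fact (Suc n) *
     (\<Sum>D\<in>J_trees 1 (Suc n) 0 a \<mu>. amplitude 1 (\<lambda>a \<mu> y. 1) K D (case_nat y z)))"

section \<open>The tree and one-loop functionals\<close>

lemma connected_diagrams_0 [simp]: "connected_diagrams g 0 = {}"
proof -
  have "D \<notin> connected_diagrams g 0" for D
    using connected_diagramsD(1,4)[of "fst D" "snd D" g 0] diagramsD(1)[of "fst D" "snd D" g 0] by auto
  then show ?thesis by blast
qed

text \<open>For each position \<open>j\<close> of the source, the trees are relabelled to have it at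
  vertex \<open>0\<close>. The remaining positions become \<open>x \<circ> skip j\<close>, as in
  \<open>source_integral\<close>.\<close>

lemma tree_decomposition:
  "W_loop 0 g J K = W_loop 0 g (\<lambda>a \<mu> y. 0) K + source_integral J (H_functional K)"
proof (intro ext)
  fix n x
  show "W_loop 0 g J K n x = (W_loop 0 g (\<lambda>a \<mu> y. 0) K + source_integral J (H_functional K)) n x"
  proof (cases n)
    \<comment> \<open>The empty diagram has no source, which matches the value 0 of
      \<open>source_integral\<close> at order 0.\<close>
    case 0
    then show ?thesis by (simp add: W_loop_def)
  next
    case (Suc m)
    have "(\<Sum>D\<in>J_trees g n j a \<mu>. amplitude 1 (\<lambda>a \<mu> y. 1) K D x) =
      (\<Sum>D\<in>J_trees 1 n 0 a \<mu>. amplitude 1 (\<lambda>a \<mu> y. 1) K D (case_nat (x j) (x \<circ> skip j)))"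
      if "j < n" for j a \<mu>
    proof -
      have "x \<circ> case_nat j (skip j) = case_nat (x j) (x \<circ> skip j)"
        by (auto simp: fun_eq_iff split: nat.splits)
      then show ?thesis
        using that skip_permutes[of j m] Suc J_trees_indep[OF that, of g a \<mu> 1]
          sum_J_trees_relabel[of "case_nat j (skip j)" n 0 j 1 "\<lambda>a \<mu> y. 1" K x a \<mu>] by simp
    qed
    then have "(\<Sum>j<n. \<Sum>a\<in>UNIV. \<Sum>\<mu>\<in>UNIV. of_real (J a \<mu> (x j)) *
        (\<Sum>D\<in>J_trees g n j a \<mu>. amplitude 1 (\<lambda>a \<mu> y. 1) K D x)) =
      (\<Sum>j<n. \<Sum>a\<in>UNIV. \<Sum>\<mu>\<in>UNIV. of_real (J a \<mu> (x j)) *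
        (\<Sum>D\<in>J_trees 1 n 0 a \<mu>. amplitude 1 (\<lambda>a \<mu> y. 1) K D (case_nat (x j) (x \<circ> skip j))))"
      by (intro sum.cong refl) simp
    moreover have "- \<i> / fact n * \<dots> = source_integral J (H_functional K) n x"
      unfolding Suc source_integral.simps H_functional_def lessThan_Suc_atMost sum_distrib_left
        sum_divide_distrib
      by (intro sum.cong refl) (simp add: field_simps del: of_nat_Suc)
    ultimately show ?thesis
      unfolding W_loop_def plus_fun_apply sum_tree_amplitudes[of g J K x n] distrib_left by simp
  qed
qed

text \<open>Trees with a \<open>J\<close> source vanish here, and by \<open>loop_counting\<close>
  the others are of order exactly 1 in \<open>g\<close>.\<close>

lemma W_loop_0_no_J_scale:
  "W_loop 0 g (\<lambda>a \<mu> y. 0) K n x = of_real g * W_loop 0 1 (\<lambda>a \<mu> y. 0) K n x"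
proof -
  have amp: "amplitude g (\<lambda>a \<mu> y. 0) K D x = of_real g * amplitude 1 (\<lambda>a \<mu> y. 0) K D x"
    if D: "D \<in> connected_diagrams g n" "loops D = 0" for D
  proof (cases "J_order D = 0")
    case True
    then have "g_order D = 1" using loop_counting[OF D(1)] D(2) by simp
    then show ?thesis using amplitude_scale[of D g n "\<lambda>a \<mu> y. 0" K x] D by (simp add: connected_diagrams_def)
  qed (simp add: amplitude_no_J)
  show ?thesis
  proof (cases "g = 0")
    \<comment> \<open>At coupling 0 the set of diagrams may differ from that at coupling 1, but
      every amplitude carries the factor \<open>g\<close>.\<close>
    case True
    then have "W_loop 0 g (\<lambda>a \<mu> y. 0) K n x = 0"
      unfolding W_loop_def using amp by simp
    then show ?thesis using True by simp
  next
    case False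
    then have "connected_diagrams g n = connected_diagrams 1 n"
      using connected_diagrams_indep[of _ g n 1] connected_diagrams_indep[of _ 1 n g] by auto
    then show ?thesis using amp by (simp add: W_loop_def sum_distrib_left mult.left_commute)
  qed
qed

text \<open>One loop exhausts the sum in \<open>loop_counting\<close>, leaving no \<open>g\<close>
  and no \<open>J\<close> in the diagrams or in their amplitudes.\<close>

lemma one_loop_indep: "W_loop 1 g J K n x = W_loop 1 g' J' K n x"
proof -
  have orders: "g_order D = 0" "J_order D = 0" if "D \<in> connected_diagrams g n" "loops D = 1" for D g
    using loop_counting[OF that(1)] that(2) by auto
  have indep: "D \<in> connected_diagrams g' n" if "D \<in> connected_diagrams g n" "loops D = 1" for D g g'
    using connected_diagrams_indep[OF that(1)] orders(1)[OF that] by blast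
  then have "{D \<in> connected_diagrams g n. loops D = 1} = {D \<in> connected_diagrams g' n. loops D = 1}"
    by blast
  moreover have "amplitude g J K D x = amplitude g' J' K D x"
    if D: "D \<in> {D \<in> connected_diagrams g' n. loops D = 1}" for D
  proof -
    from D indep have D': "D \<in> connected_diagrams g n" "D \<in> connected_diagrams g' n" "loops D = 1" by blast+
    then have diag: "D \<in> diagrams g n" "D \<in> diagrams g' n" by (simp_all add: connected_diagrams_def)
    show ?thesis
      using amplitude_scale[OF diag(1), of J K x] amplitude_scale[OF diag(2), of J' K x]
        orders[OF D'(1,3)] amplitude_cong_J[of D 1 J K x J'] by simp
  qed
  ultimately show ?thesis
    unfolding W_loop_def by (intro arg_cong2[where f = "(*)"] refl sum.cong)
qed

theorem proposition1:
  shows "(\<forall>(g :: real) n. \<forall>D\<in>connected_diagrams g n. loops D = 0 \<or> loops D = 1)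
    \<and> (\<forall>(g :: real) (J :: source) (K :: source). W g J K = W_loop 0 g J K + W_loop 1 g J K)
    \<and> (\<exists>(U :: real \<Rightarrow> source \<Rightarrow> formal_functional)
          (H :: source \<Rightarrow> 3 \<Rightarrow> 3 \<Rightarrow> real^3 \<Rightarrow> formal_functional).
          (\<forall>g J K. W_loop 0 g J K = U g K + source_integral J (H K))
        \<and> (\<forall>K n x. linear (\<lambda>g. U g K n x)))
    \<and> (\<forall>g g' J J' K. W_loop 1 g J K = W_loop 1 g' J' K)"
proof (intro conjI allI ballI)
  show loops: "loops D = 0 \<or> loops D = 1" if "D \<in> connected_diagrams g n" for g n D
    using loop_counting[OF that] by auto
  show "W g J K = W_loop 0 g J K + W_loop 1 g J K" for g J K
  proof (intro ext)
    fix n x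
    have "connected_diagrams g n = {D \<in> connected_diagrams g n. loops D = 0} \<union>
        {D \<in> connected_diagrams g n. loops D = 1}"
      using loops by blast
    moreover have "finite (connected_diagrams g n)"
      using finite_diagrams[of g n] by (auto simp: connected_diagrams_def)
    ultimately have "(\<Sum>D\<in>connected_diagrams g n. amplitude g J K D x) =
        (\<Sum>D\<in>{D \<in> connected_diagrams g n. loops D = 0}. amplitude g J K D x) +
        (\<Sum>D\<in>{D \<in> connected_diagrams g n. loops D = 1}. amplitude g J K D x)"
      by (subst sum.union_disjoint[symmetric]) auto
    then show "W g J K n x = (W_loop 0 g J K + W_loop 1 g J K) n x"
      by (simp add: W_def W_loop_def ring_distribs)
  qed
  have "linear (\<lambda>g. W_loop 0 g (\<lambda>a \<mu> y. 0) K n x)" for K n x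
    by (subst W_loop_0_no_J_scale) (auto intro!: linearI simp: ring_distribs scaleR_conv_of_real)
  then show "\<exists>(U :: real \<Rightarrow> source \<Rightarrow> formal_functional)
          (H :: source \<Rightarrow> 3 \<Rightarrow> 3 \<Rightarrow> real^3 \<Rightarrow> formal_functional).
          (\<forall>g J K. W_loop 0 g J K = U g K + source_integral J (H K))
        \<and> (\<forall>K n x. linear (\<lambda>g. U g K n x))"
    \<comment> \<open>\<open>U\<close> is the tree functional at \<open>J = 0\<close>, and
      \<open>H\<close> is built from amplitudes at coupling 1.\<close>
    by (intro exI[of _ "\<lambda>g. W_loop 0 g (\<lambda>a \<mu> y. 0)"] exI[of _ H_functional] conjI allI tree_decomposition)
  show "W_loop 1 g J K = W_loop 1 g' J' K" for g g' J J' K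
    by (intro ext one_loop_indep)
qed

end
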